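(* Let $\mathcal H$ be a complex Hilbert space of finite dimension $N$, let $A=A^\ast$ on $\mathcal H$, and let $e\in\mathcal H$ be a unit vector that is cyclic for $A$. For $\gamma\in\mathbb C$ let $A_\gamma f=Af+\gamma\langle f,e\rangle e$, and for $\theta\in(0,\pi)$ let $$S_\theta=\bigcup_{t>0}\operatorname{Spec}(A_{t e^{i\theta}}).$$ Let $\lambda_1,\dots,\lambda_N$ be the eigenvalues of $A$ written in increasing order, let $\delta_1,\dots,\delta_{N-1}$ be the eigenvalues of the truncation $A^\natural$ of $A$ to $\{f\in\mathcal H:\langle f,e\rangle=0\}$ written in increasing order, and let $\delta_N=\infty$. Then there exists a finite set $T\subset(0,\pi)$ such that if $\theta\in(0,\pi)\setminus T$ then $S_\theta$ is the union of $N$ disjoint simple analytic curves. Each curve starts at some $\lambda_r\in\operatorname{Spec}(A)$ and ends at $\delta_{\tau(r)}$, where $\tau$ is a permutation of $\{1,2,\dots,N\}$. This permutation is constant in each subinterval $J$ of $(0,\pi)\setminus T$, but it may change from one interval to another (that is, there exist a finite-dimensional complex Hilbert space $\mathcal H$, a self-adjoint operator $A$ on $\mathcal H$ and a unit vector $e\in\mathcal H$ that is cyclic for $A$, for which $\tau$ is not the same on all the subintervals).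
   Context: A vector $e$ is cyclic for $A$ if $\operatorname{lin}\{A^ne:n=0,1,2,\dots\}$ is dense in (here: equal to) $\mathcal H$. The truncation of $A$ to a subspace $\mathcal K$ is $PAP|_{\mathcal K}$, where $P$ is the orthogonal projection onto $\mathcal K$. A simple analytic curve is (the image of) a one-one real analytic map $\sigma:(0,\infty)\to\mathbb C_+=\{z:\operatorname{Im}(z)>0\}$ with $\sigma'(t)\ne0$ for all $t\in(0,\infty)$. It starts at $\lim_{t\to0}\sigma(t)$ and ends at $\lim_{t\to\infty}\sigma(t)$, where the limit $\infty$ means $|\sigma(t)|\to\infty$. *)

theory Defs
  imports "HOL-Analysis.Analysis" "HOL-Library.Function_Algebras"
begin

definition real_analytic_on :: "(real \<Rightarrow> complex) \<Rightarrow> real set \<Rightarrow> bool"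
  where "real_analytic_on f S \<longleftrightarrow>
    (\<forall>t0\<in>S. \<exists>a :: nat \<Rightarrow> complex. \<exists>r>0. \<forall>t\<in>S. \<bar>t - t0\<bar> < r \<longrightarrow>
       (\<lambda>n. a n * of_real (t - t0) ^ n) sums f t)"

text \<open>A curve is represented by a parametrisation; as a subset of the plane it is the image of
  \<open>{0<..}\<close>.\<close>

definition simple_analytic_curve :: "(real \<Rightarrow> complex) \<Rightarrow> bool"
  where "simple_analytic_curve \<sigma> \<longleftrightarrow>
    real_analytic_on \<sigma> {0<..} \<and> inj_on \<sigma> {0<..} \<and> \<sigma> ` {0<..} \<subseteq> {z. Im z > 0} \<and>
    (\<forall>t>0. vector_derivative \<sigma> (at t) \<noteq> 0)"

definition starts_at :: "(real \<Rightarrow> complex) \<Rightarrow> complex \<Rightarrow> bool"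
  where "starts_at \<sigma> z \<longleftrightarrow> (\<sigma> \<longlongrightarrow> z) (at_right 0)"

definition ends_at :: "(real \<Rightarrow> complex) \<Rightarrow> complex \<Rightarrow> bool"
  where "ends_at \<sigma> z \<longleftrightarrow> (\<sigma> \<longlongrightarrow> z) at_top"

definition ends_at_infinity :: "(real \<Rightarrow> complex) \<Rightarrow> bool"
  where "ends_at_infinity \<sigma> \<longleftrightarrow> filterlim (\<lambda>t. cmod (\<sigma> t)) at_top at_top"

text \<open>A finite-dimensional complex Hilbert space is a finite-dimensional subspace \<open>H\<close> of some
  complex vector space, with an inner product (linear in the first argument) that is only
  constrained on \<open>H\<close>. Completeness is automatic. Having \<open>H\<close> as a set rather than a type allows
  one to quantify existentially over Hilbert spaces of arbitrary finite dimension; taking \<open>H = UNIV\<close>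
  gives the case of a space that is a whole type. Operators on \<open>H\<close> are functions on the ambient
  type of which only the values on \<open>H\<close> matter.\<close>

locale finite_dim_hilbert_space = vector_space scale
  for scale :: "complex \<Rightarrow> 'a::ab_group_add \<Rightarrow> 'a"  (infixr "*\<^sub>C" 75) +
  fixes H :: "'a set" and ip :: "'a \<Rightarrow> 'a \<Rightarrow> complex"
  assumes subspace_H: "subspace H"
    and finite_dim: "\<exists>B. finite B \<and> span B = H"
    and ip_add_left: "\<lbrakk>f \<in> H; g \<in> H; h \<in> H\<rbrakk> \<Longrightarrow> ip (f + g) h = ip f h + ip g h"
    and ip_scale_left: "\<lbrakk>f \<in> H; g \<in> H\<rbrakk> \<Longrightarrow> ip (c *\<^sub>C f) g = c * ip f g"
    and ip_commute: "\<lbrakk>f \<in> H; g \<in> H\<rbrakk> \<Longrightarrow> ip f g = cnj (ip g f)"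
    and ip_pos: "\<lbrakk>f \<in> H; f \<noteq> 0\<rbrakk> \<Longrightarrow> Re (ip f f) > 0"
begin

definition linear_operator :: "('a \<Rightarrow> 'a) \<Rightarrow> bool"
  where "linear_operator L \<longleftrightarrow> L ` H \<subseteq> H \<and>
    (\<forall>f\<in>H. \<forall>g\<in>H. L (f + g) = L f + L g) \<and> (\<forall>c. \<forall>f\<in>H. L (c *\<^sub>C f) = c *\<^sub>C L f)"

definition self_adjoint :: "('a \<Rightarrow> 'a) \<Rightarrow> bool"
  where "self_adjoint L \<longleftrightarrow> (\<forall>f\<in>H. \<forall>g\<in>H. ip (L f) g = ip f (L g))"

definition cyclic_vector :: "'a \<Rightarrow> ('a \<Rightarrow> 'a) \<Rightarrow> bool"
  where "cyclic_vector e L \<longleftrightarrow> e \<in> H \<and> span (range (\<lambda>n. (L ^^ n) e)) = H"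

definition Spec :: "('a \<Rightarrow> 'a) \<Rightarrow> complex set"
  where "Spec L = {z. \<not> bij_betw (\<lambda>f. L f - z *\<^sub>C f) H H}"

definition orthogonal_projection :: "'a set \<Rightarrow> 'a \<Rightarrow> 'a"
  where "orthogonal_projection K f = (THE g. g \<in> K \<and> (\<forall>k\<in>K. ip (f - g) k = 0))"

text \<open>To be regarded as an operator on \<open>K\<close>; its values off \<open>K\<close> are irrelevant.\<close>

definition truncation :: "('a \<Rightarrow> 'a) \<Rightarrow> 'a set \<Rightarrow> 'a \<Rightarrow> 'a"
  where "truncation L K f =
    orthogonal_projection K (L (orthogonal_projection K f))"

definition eigenvalues :: "'a set \<Rightarrow> ('a \<Rightarrow> 'a) \<Rightarrow> complex set"
  where "eigenvalues K L = {z. \<exists>f\<in>K. f \<noteq> 0 \<and> L f = z *\<^sub>C f}"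

text \<open>The \<open>k\<close>-th real eigenvalue in increasing order, for \<open>k = 1, 2, \<dots>\<close>, listed without
  multiplicity. It is used below only for \<open>A\<close> and its truncation, both self-adjoint with
  simple spectrum because \<open>e\<close> is cyclic.\<close>

definition ordered_eigenvalue :: "'a set \<Rightarrow> ('a \<Rightarrow> 'a) \<Rightarrow> nat \<Rightarrow> real"
  where "ordered_eigenvalue K L k =
    sorted_list_of_set {x :: real. complex_of_real x \<in> eigenvalues K L} ! (k - 1)"

end

locale cyclic_self_adjoint = finite_dim_hilbert_space scale H ip
  for scale :: "complex \<Rightarrow> 'a::ab_group_add \<Rightarrow> 'a"  (infixr "*\<^sub>C" 75)
    and H :: "'a set" and ip :: "'a \<Rightarrow> 'a \<Rightarrow> complex" +
  fixes A :: "'a \<Rightarrow> 'a" and e :: 'a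
  assumes linear_A: "linear_operator A"
    and self_adjoint_A: "self_adjoint A"
    and cyclic_e: "cyclic_vector e A"
    and unit_e: "ip e e = 1"
begin

definition N :: nat
  where "N = dim H"

definition perturbed :: "complex \<Rightarrow> 'a \<Rightarrow> 'a"
  where "perturbed \<gamma> f = A f + (\<gamma> * ip f e) *\<^sub>C e"

definition spectral_curve :: "real \<Rightarrow> complex set"
  where "spectral_curve \<theta> = (\<Union>t\<in>{0<..}. Spec (perturbed (of_real t * cis \<theta>)))"

definition complement_e :: "'a set"
  where "complement_e = {f \<in> H. ip f e = 0}"

definition lam :: "nat \<Rightarrow> real"
  where "lam r = ordered_eigenvalue H A r"

definition delta :: "nat \<Rightarrow> real"
  where "delta r = ordered_eigenvalue complement_e (truncation A complement_e) r"

text \<open>The curve of index \<open>r\<close> is the one that starts at the \<open>r\<close>-th eigenvalue of \<open>A\<close>. The value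
  \<open>N\<close> of the permutation stands for the end point infinity.\<close>

definition curves_with_permutation :: "real \<Rightarrow> (nat \<Rightarrow> nat) \<Rightarrow> bool"
  where "curves_with_permutation \<theta> p \<longleftrightarrow>
    p permutes {1..N} \<and>
    (\<exists>\<sigma> :: nat \<Rightarrow> real \<Rightarrow> complex.
       spectral_curve \<theta> = (\<Union>r\<in>{1..N}. \<sigma> r ` {0<..}) \<and>
       disjoint_family_on (\<lambda>r. \<sigma> r ` {0<..}) {1..N} \<and>
       (\<forall>r\<in>{1..N}. simple_analytic_curve (\<sigma> r) \<and>
          starts_at (\<sigma> r) (of_real (lam r)) \<and>
          (if p r = N then ends_at_infinity (\<sigma> r)
           else ends_at (\<sigma> r) (of_real (delta (p r))))))"

definition exceptional_set_with_permutations :: "real set \<Rightarrow> (real \<Rightarrow> nat \<Rightarrow> nat) \<Rightarrow> bool"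
  where "exceptional_set_with_permutations T \<tau> \<longleftrightarrow>
    finite T \<and> T \<subseteq> {0<..<pi} \<and>
    (\<forall>\<theta>\<in>{0<..<pi} - T. curves_with_permutation \<theta> (\<tau> \<theta>)) \<and>
    (\<forall>J\<in>components ({0<..<pi} - T). \<tau> constant_on J)"

end

end

theory Submission
  imports Defs "HOL-Complex_Analysis.Complex_Analysis"
    "HOL-Computational_Algebra.Fundamental_Theorem_Algebra"
begin

text \<open>
  Let \<open>e = \<Sum>x\<in>L. u x\<close> be the decomposition of the cyclic vector into eigenvectors of \<open>A\<close>, where
  \<open>L\<close> is the spectrum of \<open>A\<close>, and let \<open>F z = \<Sum>x\<in>L. w x / (z - x)\<close> with \<open>w x = \<parallel>u x\<parallel>\<^sup>2\<close>. This is the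
  diagonal element of the resolvent of \<open>A\<close> at \<open>e\<close>. In the coordinates of the eigenbasis, for
  \<open>\<gamma> \<noteq> 0\<close>, the spectrum of \<open>A\<^sub>\<gamma>\<close> is the solution set of \<open>1 / F z = \<gamma>\<close>, and the spectrum of the
  truncation consists of the zeros of \<open>F\<close>. So \<open>S\<^sub>\<theta>\<close> is the preimage of the open ray of angle \<open>\<theta>\<close> under
  the rational function \<open>G = 1 / F\<close>. With the coprime polynomials \<open>P = \<Prod>x\<in>L. z - x\<close> and \<open>Q = F * P\<close>
  the equation reads \<open>P = \<gamma> * Q\<close>, where \<open>P - \<gamma> * Q\<close> is monic of degree \<open>N\<close>.

  The imaginary part of \<open>F z\<close> has the sign opposite to that of \<open>Im z\<close>. Hence the preimage of the
  upper half-plane under \<open>G\<close> is the upper half-plane, the zeros of \<open>F\<close> are real and simple, and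
  there are \<open>N - 1\<close> of them. \<open>G\<close> has only finitely many critical values in the upper half-plane;
  the exceptional set \<open>T\<close> consists of their arguments. Every other value in the upper half-plane has
  exactly \<open>N\<close> preimages, and this count makes \<open>G\<close> a covering map away from the critical values
  (\<open>covering_G\<close>).

  For a component \<open>J\<close> of the complement of \<open>T\<close>, the exponential function maps the strip
  \<open>{v. Im v \<in> J}\<close> into the regular values. The strip is convex, so \<open>exp\<close> has \<open>N\<close> holomorphic
  lifts through \<open>G\<close>, and these enumerate every fibre (\<open>root_branches\<close>). Restricted to the horizontal
  line of height \<open>\<theta>\<close>, parametrised by the logarithm, the lifts are the required curves. Over small
  values every fibre consists of one point near each element of \<open>L\<close>, over large values of one point
  near each zero of \<open>F\<close> and one point near infinity. The ends of the strip are connected, so each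
  lift stays near one of these points at each end, with the same choice for all \<open>\<theta> \<in> J\<close>
  (\<open>branch_endpoints\<close>). This gives the permutation and shows that it is constant on \<open>J\<close>.

  The permutation changes already for the matrix that exchanges the two coordinates of \<open>\<complex>\<^sup>2\<close>, with
  \<open>e\<close> the first unit vector, for which \<open>G z = z - 1 / z\<close>. The real part of \<open>G\<close> vanishes on the imaginary
  axis and on the unit circle. Therefore the curve that starts at \<open>1\<close> stays in the right half-plane,
  outside the unit disc if \<open>\<theta> < \<pi> / 2\<close> and inside it if \<open>\<theta> > \<pi> / 2\<close>; it ends at \<open>\<infinity>\<close> in the first
  case and at \<open>0\<close> in the second.
\<close>

section \<open>The Cauchy transform of a finitely supported probability measure\<close>

lemma card_rsquarefree_roots:
  fixes p :: "complex poly"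
  assumes "rsquarefree p"
  shows "card {z. poly p z = 0} = degree p"
proof -
  have "p \<noteq> 0" using assms rsquarefree_def by blast
  then have "degree p = degree (smult (lead_coeff p) (\<Prod>z|poly p z = 0. [:-z, 1:]))"
    by (simp add: complex_poly_decompose_rsquarefree[OF assms])
  also have "\<dots> = card {z. poly p z = 0}"
    using \<open>p \<noteq> 0\<close> by (simp add: degree_prod_eq_sum_degree)
  finally show ?thesis by simp
qed

text \<open>A probability measure on the real line with finite support. In the application it is the spectral
  measure of \<open>A\<close> at the unit vector \<open>e\<close>.\<close>

locale herglotz_data =
  fixes L :: "real set" and w :: "real \<Rightarrow> real"
  assumes finite_L: "finite L"
    and w_pos: "x \<in> L \<Longrightarrow> w x > 0"
    and w_total: "sum w L = 1"
begin

definition F :: "complex \<Rightarrow> complex"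
  where "F z = (\<Sum>x\<in>L. of_real (w x) / (z - of_real x))"

definition P :: "complex poly"
  where "P = (\<Prod>x\<in>L. [:- of_real x, 1:])"

definition Q :: "complex poly"
  where "Q = (\<Sum>x\<in>L. smult (of_real (w x)) (\<Prod>y\<in>L - {x}. [:- of_real y, 1:]))"

text \<open>The fibre of \<open>1 / F\<close> over \<open>\<gamma>\<close>. The polynomial form of the equation makes the number of its solutions
  visible and has a meaning at the poles and zeros of \<open>F\<close>.\<close>

definition roots :: "complex \<Rightarrow> complex set"
  where "roots \<gamma> = {z. poly P z = \<gamma> * poly Q z}"

definition zeros :: "real set"
  where "zeros = {x. poly Q (of_real x) = 0}"

lemma L_nonempty: "L \<noteq> {}"
  using w_total by auto

lemma card_L_pos: "card L > 0"
  using L_nonempty finite_L by (simp add: card_gt_0_iff)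

lemma poly_P: "poly P z = (\<Prod>x\<in>L. z - of_real x)"
  by (simp add: P_def poly_prod)

lemma poly_P_eq_0_iff: "poly P z = 0 \<longleftrightarrow> z \<in> of_real ` L"
  using finite_L by (auto simp: poly_P)

lemma degree_P: "degree P = card L"
  by (simp add: P_def degree_prod_eq_sum_degree)

lemma lead_coeff_P: "coeff P (card L) = 1"
proof -
  have "lead_coeff P = 1" by (simp add: P_def lead_coeff_prod)
  then show ?thesis by (simp add: degree_P)
qed

lemma poly_Q: "poly Q z = (\<Sum>x\<in>L. of_real (w x) * (\<Prod>y\<in>L - {x}. z - of_real y))"
  by (simp add: Q_def poly_sum poly_prod)

lemma poly_Q_eq:
  assumes "z \<notin> of_real ` L"
  shows "poly Q z = F z * poly P z"
proof -
  have "of_real (w x) * (\<Prod>y\<in>L - {x}. z - of_real y) = of_real (w x) / (z - of_real x) * (\<Prod>y\<in>L. z - of_real y)"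
    if "x \<in> L" for x
  proof -
    have "z - of_real x \<noteq> 0" using assms that by auto
    then show ?thesis using prod.remove[OF finite_L that, of "\<lambda>y. z - of_real y"] by simp
  qed
  then show ?thesis by (simp add: poly_Q F_def poly_P sum_distrib_right)
qed

lemma poly_Q_at_pole:
  assumes "x \<in> L"
  shows "poly Q (of_real x) \<noteq> 0"
proof -
  have "poly Q (of_real x) = (\<Sum>v\<in>L. if v = x then of_real (w x) * (\<Prod>y\<in>L - {x}. of_real x - of_real y) else 0)"
    unfolding poly_Q
    using assms finite_L by (intro sum.cong) (auto intro!: prod_zero)
  also have "\<dots> = of_real (w x) * (\<Prod>y\<in>L - {x}. of_real x - of_real y)"
    using assms finite_L by simp
  also have "\<dots> \<noteq> 0" using w_pos[OF assms] finite_L by simp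
  finally show ?thesis .
qed

lemma degree_Q_summand:
  assumes "x \<in> L"
  shows "degree (\<Prod>y\<in>L - {x}. [:- complex_of_real y, 1:]) = card L - 1"
    and "coeff (\<Prod>y\<in>L - {x}. [:- complex_of_real y, 1:]) (card L - 1) = 1"
proof -
  show *: "degree (\<Prod>y\<in>L - {x}. [:- complex_of_real y, 1:]) = card L - 1"
    using assms finite_L by (simp add: degree_prod_eq_sum_degree)
  have "lead_coeff (\<Prod>y\<in>L - {x}. [:- complex_of_real y, 1:]) = 1"
    by (simp add: lead_coeff_prod)
  then show "coeff (\<Prod>y\<in>L - {x}. [:- complex_of_real y, 1:]) (card L - 1) = 1"
    by (simp only: *)
qed

lemma coeff_Q: "coeff Q (card L - 1) = 1"
proof -
  have "coeff Q (card L - 1) = of_real (sum w L)"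
    by (simp add: Q_def coeff_sum degree_Q_summand del: One_nat_def)
  then show ?thesis by (simp add: w_total)
qed

lemma degree_Q: "degree Q = card L - 1"
proof (rule antisym)
  show "degree Q \<le> card L - 1"
    unfolding Q_def
  proof (rule degree_sum_le[OF finite_L])
    fix x assume "x \<in> L"
    from degree_Q_summand(1)[OF this]
    show "degree (smult (of_real (w x)) (\<Prod>y\<in>L - {x}. [:- complex_of_real y, 1:])) \<le> card L - 1"
      by (metis degree_smult_le)
  qed
  show "card L - 1 \<le> degree Q" using coeff_Q by (intro le_degree) simp
qed

text \<open>Each summand of \<open>F\<close> contributes \<open>- w x / \<bar>z - x\<bar>\<^sup>2 * Im z\<close> to the imaginary part. This sign
  property is the source of all statements about half-planes and about real zeros.\<close>

lemma Im_F:
  assumes "z \<notin> of_real ` L"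
  obtains k where "k > 0" "Im (F z) = - (k * Im z)"
proof
  have *: "Im (of_real (w x) / (z - of_real x)) = - (w x / (cmod (z - of_real x))\<^sup>2 * Im z)" for x
    by (simp add: Im_divide cmod_power2)
  have "Im (F z) = (\<Sum>x\<in>L. - (w x / (cmod (z - of_real x))\<^sup>2 * Im z))"
    by (simp only: F_def Im_sum *)
  then show "Im (F z) = - ((\<Sum>x\<in>L. w x / (cmod (z - of_real x))\<^sup>2) * Im z)"
    by (simp only: sum_negf sum_distrib_right)
  show "(\<Sum>x\<in>L. w x / (cmod (z - of_real x))\<^sup>2) > 0"
    using assms by (intro sum_pos finite_L L_nonempty divide_pos_pos w_pos) auto
qed

lemma upper_not_pole: "Im z \<noteq> 0 \<Longrightarrow> z \<notin> of_real ` L"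
  by auto

lemma upper_F_nonzero:
  assumes "Im z > 0"
  shows "Im (F z) < 0" "F z \<noteq> 0"
proof -
  show "Im (F z) < 0" using assms Im_F[of z] upper_not_pole[of z]
    by (metis less_irrefl neg_less_0_iff_less zero_less_mult_iff)
  then show "F z \<noteq> 0" by auto
qed

lemma mem_roots_iff:
  assumes "\<gamma> \<noteq> 0"
  shows "z \<in> roots \<gamma> \<longleftrightarrow> z \<notin> of_real ` L \<and> \<gamma> * F z = 1"
proof (cases "z \<in> of_real ` L")
  case True
  then show ?thesis using assms poly_Q_at_pole poly_P_eq_0_iff[of z] by (auto simp: roots_def)
next
  case False
  then have "poly P z \<noteq> 0" by (simp add: poly_P_eq_0_iff)
  then show ?thesis using False by (auto simp: roots_def poly_Q_eq)
qed

lemma roots_upper: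
  assumes "Im \<gamma> > 0" "z \<in> roots \<gamma>"
  shows "Im z > 0"
proof -
  have "\<gamma> \<noteq> 0" using assms by auto
  then have z: "z \<notin> of_real ` L" and "\<gamma> * F z = 1" using assms mem_roots_iff by auto
  then have "F z = inverse \<gamma>" using inverse_unique by metis
  then have "Im (F z) < 0" using assms by (simp add: complex_inverse divide_neg_pos sum_power2_gt_zero_iff)
  moreover obtain k where "k > 0" "Im (F z) = - (k * Im z)" using Im_F[OF z] .
  ultimately show ?thesis by (simp add: zero_less_mult_iff)
qed

lemma roots_Q_nonzero:
  assumes "z \<in> roots \<gamma>"
  shows "poly Q z \<noteq> 0"
  using assms poly_P_eq_0_iff[of z] poly_Q_at_pole by (auto simp: roots_def)

lemma mem_roots_upper:
  assumes "Im z > 0" shows "z \<in> roots \<gamma> \<longleftrightarrow> \<gamma> = inverse (F z)"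
proof (cases "\<gamma> = 0")
  case True
  have "z \<notin> roots 0" using assms poly_P_eq_0_iff[of z] by (auto simp: roots_def)
  then show ?thesis using True upper_F_nonzero[OF assms] by auto
next
  case False
  then show ?thesis using mem_roots_iff[OF False] upper_not_pole[of z] assms upper_F_nonzero[OF assms]
    by (auto simp: field_simps)
qed

lemma Im_inverse_F: "Im z > 0 \<Longrightarrow> Im (inverse (F z)) > 0"
  using upper_F_nonzero[of z] by (simp add: complex_inverse divide_neg_pos sum_power2_gt_zero_iff)

lemma roots_poly: "roots \<gamma> = {z. poly (P - smult \<gamma> Q) z = 0}"
  by (simp add: roots_def)

lemma degree_roots_poly: "degree (P - smult \<gamma> Q) = card L" "P - smult \<gamma> Q \<noteq> 0"
proof -
  have "coeff (smult \<gamma> Q) (card L) = 0"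
    using degree_Q card_L_pos by (simp add: coeff_eq_0)
  then have c: "coeff (P - smult \<gamma> Q) (card L) = 1"
    using lead_coeff_P by simp
  then show "P - smult \<gamma> Q \<noteq> 0" by auto
  have "degree (P - smult \<gamma> Q) \<le> card L"
    using degree_diff_le[of P "card L" "smult \<gamma> Q"] degree_P degree_Q degree_smult_le[of \<gamma> Q] by simp
  moreover have "card L \<le> degree (P - smult \<gamma> Q)" using c by (intro le_degree) simp
  ultimately show "degree (P - smult \<gamma> Q) = card L" by simp
qed

lemma finite_roots: "finite (roots \<gamma>)"
  unfolding roots_poly using poly_roots_finite degree_roots_poly(2) by blast

text \<open>The values of \<open>1 / F\<close> at its critical points in the upper half-plane: at a root of \<open>P - \<gamma> * Q\<close>,
  the derivative of \<open>P / Q\<close> vanishes exactly if that root is multiple.\<close>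

definition critical_values :: "complex set"
  where "critical_values =
    {\<gamma>. Im \<gamma> > 0 \<and> (\<exists>z\<in>roots \<gamma>. poly (pderiv P) z = \<gamma> * poly (pderiv Q) z)}"

lemma card_roots_regular:
  assumes "Im \<gamma> > 0" "\<gamma> \<notin> critical_values"
  shows "card (roots \<gamma>) = card L"
proof -
  have "rsquarefree (P - smult \<gamma> Q)"
    unfolding rsquarefree_roots
    using assms by (auto simp: critical_values_def roots_def pderiv_diff pderiv_smult)
  from card_rsquarefree_roots[OF this] show ?thesis by (simp add: roots_poly degree_roots_poly)
qed

lemma pderiv_P_at_pole:
  assumes "x \<in> L" shows "poly (pderiv P) (of_real x) \<noteq> 0"
proof -
  define R where "R = (\<Prod>y\<in>L - {x}. [:- complex_of_real y, 1:])"
  have P: "P = [:- of_real x, 1:] * R"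
    unfolding P_def R_def using prod.remove[OF finite_L assms] by blast
  have "poly (pderiv P) (of_real x) = poly R (of_real x)"
    unfolding P pderiv_mult by (simp add: pderiv_pCons)
  also have "\<dots> \<noteq> 0" using finite_L by (auto simp: R_def poly_prod)
  finally show ?thesis .
qed

text \<open>The critical points are zeros of the Wronskian \<open>P' * Q - P * Q'\<close>, which is not the zero polynomial
  because at a point of \<open>L\<close> it equals \<open>P' * Q\<close> and both factors are nonzero there.\<close>

lemma finite_critical_values: "finite critical_values"
proof -
  define W where "W = pderiv P * Q - P * pderiv Q"
  obtain x where x: "x \<in> L" using L_nonempty by auto
  then have "poly P (of_real x) = 0" by (simp add: poly_P_eq_0_iff)
  then have "poly W (of_real x) \<noteq> 0"
    using pderiv_P_at_pole[OF x] poly_Q_at_pole[OF x] by (simp add: W_def)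
  then have "W \<noteq> 0" by auto
  then have "finite {z. poly W z = 0}" by (rule poly_roots_finite)
  moreover have "critical_values \<subseteq> (\<lambda>z. poly P z / poly Q z) ` {z. poly W z = 0}"
  proof
    fix \<gamma> assume "\<gamma> \<in> critical_values"
    then obtain z where z: "z \<in> roots \<gamma>" "poly (pderiv P) z = \<gamma> * poly (pderiv Q) z"
      by (auto simp: critical_values_def)
    then have "\<gamma> = poly P z / poly Q z" using roots_Q_nonzero[OF z(1)] by (simp add: roots_def)
    moreover have "poly W z = 0" using z by (simp add: W_def roots_def)
    ultimately show "\<gamma> \<in> (\<lambda>z. poly P z / poly Q z) ` {z. poly W z = 0}" by blast
  qed
  ultimately show ?thesis using finite_surj by blast
qed

lemma F_has_field_derivative:
  assumes "z \<notin> of_real ` L"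
  shows "(F has_field_derivative - (\<Sum>x\<in>L. of_real (w x) / (z - of_real x)\<^sup>2)) (at z)"
proof -
  have "((\<lambda>z. \<Sum>x\<in>L. of_real (w x) / (z - of_real x)) has_field_derivative
      (\<Sum>x\<in>L. - (of_real (w x) / (z - of_real x)\<^sup>2))) (at z)"
    using assms
    by (intro DERIV_sum) (auto intro!: derivative_eq_intros simp: power2_eq_square)
  then show ?thesis by (simp add: F_def[abs_def] sum_negf)
qed

lemma open_not_pole: "open (- complex_of_real ` L)"
  by (intro open_Compl finite_imp_closed finite_imageI finite_L)

text \<open>A zero of \<open>Q\<close> is a zero of \<open>F\<close>, hence real by the sign of \<open>Im F\<close>. It is simple because on the real
  line \<open>F'\<close> is a sum of negative terms.\<close>

lemma Q_zero:
  assumes "poly Q z = 0"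
  shows "z \<in> \<real>" "poly (pderiv Q) z \<noteq> 0"
proof -
  have zL: "z \<notin> of_real ` L" using assms poly_Q_at_pole by auto
  then have Fz: "F z = 0" using assms poly_Q_eq[OF zL] by (simp add: poly_P_eq_0_iff)
  obtain k where "k > 0" "Im (F z) = - (k * Im z)" using Im_F[OF zL] .
  then have "Im z = 0" using Fz by auto
  then show "z \<in> \<real>" by (simp add: complex_is_Real_iff)
  then obtain y where y: "z = of_real y" by (auto elim: Reals_cases)
  define D where "D = - (\<Sum>x\<in>L. complex_of_real (w x) / (z - of_real x)\<^sup>2)"
  have "D = - of_real (\<Sum>x\<in>L. w x / (y - x)\<^sup>2)" by (simp add: D_def y)
  moreover have "(\<Sum>x\<in>L. w x / (y - x)\<^sup>2) > 0"
    using zL y by (intro sum_pos finite_L L_nonempty divide_pos_pos w_pos) auto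
  ultimately have D: "D \<noteq> 0" by (simp del: of_real_sum)
  have "((\<lambda>z. F z * poly P z) has_field_derivative D * poly P z + poly (pderiv P) z * F z) (at z)"
    using F_has_field_derivative[OF zL] unfolding D_def
    by (intro DERIV_mult) auto
  then have "(poly Q has_field_derivative D * poly P z + poly (pderiv P) z * F z) (at z)"
    by (rule has_field_derivative_transform_within_open[OF _ open_not_pole])
      (use zL in \<open>auto simp: poly_Q_eq\<close>)
  from DERIV_unique[OF this poly_DERIV] have "poly (pderiv Q) z = D * poly P z" using Fz by simp
  then show "poly (pderiv Q) z \<noteq> 0" using D zL by (simp add: poly_P_eq_0_iff)
qed

lemma Q_nonzero: "Q \<noteq> 0" using coeff_Q by auto

lemma complex_zeros: "{z. poly Q z = 0} = of_real ` zeros"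
  using Q_zero(1) by (auto simp: zeros_def elim: Reals_cases)

lemma finite_zeros: "finite zeros"
proof -
  have "finite (complex_of_real ` zeros)" using poly_roots_finite[OF Q_nonzero] complex_zeros by simp
  then show ?thesis by (rule finite_imageD) (simp add: inj_on_def)
qed

lemma rsquarefree_Q: "rsquarefree Q"
  unfolding rsquarefree_roots using Q_zero(2) by blast

lemma card_zeros: "card zeros = card L - 1"
  using card_rsquarefree_roots[OF rsquarefree_Q]
  by (simp add: complex_zeros card_image inj_on_def degree_Q)

lemma poly_Q_factor: "poly Q z = (\<Prod>d\<in>zeros. z - of_real d)"
proof -
  have "Q = (\<Prod>z\<in>of_real ` zeros. [:-z, 1:])"
    using complex_poly_decompose_rsquarefree[OF rsquarefree_Q] coeff_Q by (simp add: degree_Q complex_zeros)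
  also have "\<dots> = (\<Prod>d\<in>zeros. [:- complex_of_real d, 1:])"
    by (subst prod.reindex) (auto simp: inj_on_def)
  finally show ?thesis by (simp add: poly_prod)
qed

end

section \<open>The covering of the regular values\<close>

text \<open>Stated with a filter so that it can be combined with other conditions on small radii.\<close>

lemma eventually_disjnt_balls:
  fixes R :: "'a::metric_space set"
  assumes "finite R"
  shows "\<forall>\<^sub>F r in at_right (0::real). \<forall>z\<in>R. \<forall>y\<in>R. z \<noteq> y \<longrightarrow> disjnt (ball z r) (ball y r)"
proof -
  have "\<forall>\<^sub>F r in at_right (0::real). z \<noteq> y \<longrightarrow> disjnt (ball z r) (ball y r)" for z y :: 'a
  proof (cases "z = y")
    case False
    then have "0 < dist z y / 2" by simp
    from eventually_at_right_real[OF this] show ?thesis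
    proof eventually_elim
      case (elim r)
      have "\<not> (dist z x < r \<and> dist y x < r)" for x
        using elim dist_triangle2[of z y x] by auto
      then show ?case by (simp add: disjnt_iff)
    qed
  qed simp
  then show ?thesis using assms by (intro eventually_ball_finite ballI)
qed

context herglotz_data
begin

definition G :: "complex \<Rightarrow> complex"
  where "G z = inverse (F z)"

definition regular_values :: "complex set"
  where "regular_values = {\<gamma>. Im \<gamma> > 0} - critical_values"

definition regular_points :: "complex set"
  where "regular_points = {z. Im z > 0} \<inter> G -` regular_values"

lemma G_holomorphic: "G holomorphic_on {z. Im z > 0}"
proof -
  have "F field_differentiable at z" if "Im z > 0" for z
    using F_has_field_derivative[of z] upper_not_pole[of z] that by (auto simp: field_differentiable_def)
  then have "F holomorphic_on {z. Im z > 0}"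
    by (simp add: field_differentiable_at_within holomorphic_on_def)
  then have "(\<lambda>z. inverse (F z)) holomorphic_on {z. Im z > 0}"
    by (intro holomorphic_intros) (auto dest: upper_F_nonzero)
  then show ?thesis by (simp add: G_def[abs_def])
qed

lemma poly_P_upper: "Im z > 0 \<Longrightarrow> poly P z = G z * poly Q z"
  using mem_roots_upper[of z "G z"] by (simp add: G_def roots_def)

lemma mem_roots_G: "Im z > 0 \<Longrightarrow> z \<in> roots \<gamma> \<longleftrightarrow> G z = \<gamma>"
  by (auto simp: mem_roots_upper G_def)

lemma open_upper: "open {z. Im z > 0}"
  by (rule open_halfspace_Im_gt)

text \<open>Differentiating \<open>P = G * Q\<close> at a zero of \<open>G'\<close> gives \<open>P' = G * Q'\<close>, so the value of \<open>G\<close> there is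
  critical.\<close>

lemma deriv_G_nonzero:
  assumes "z \<in> regular_points"
  shows "deriv G z \<noteq> 0"
proof
  assume 0: "deriv G z = 0"
  have z: "Im z > 0" "G z \<in> regular_values" using assms by (auto simp: regular_points_def)
  have "(G has_field_derivative deriv G z) (at z)"
    using G_holomorphic open_upper z by (simp add: holomorphic_derivI)
  then have "((\<lambda>z. G z * poly Q z) has_field_derivative
      deriv G z * poly Q z + poly (pderiv Q) z * G z) (at z)"
    by (intro DERIV_mult) auto
  then have "(poly P has_field_derivative deriv G z * poly Q z + poly (pderiv Q) z * G z) (at z)"
    by (rule has_field_derivative_transform_within_open[OF _ open_upper])
      (use z in \<open>auto simp: poly_P_upper\<close>)
  from DERIV_unique[OF this poly_DERIV] 0 have "poly (pderiv P) z = G z * poly (pderiv Q) z" by (simp add: mult.commute)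
  then have "G z \<in> critical_values"
    using Im_inverse_F[OF z(1)] mem_roots_G[OF z(1)] by (auto simp: critical_values_def G_def)
  then show False using z by (auto simp: regular_values_def)
qed

lemma open_regular_values: "open regular_values"
  unfolding regular_values_def
  by (intro open_Diff open_upper finite_imp_closed finite_critical_values)

lemma G_local_inverse:
  assumes "z \<in> regular_points"
  obtains r where "r > 0" "ball z r \<subseteq> {z. Im z > 0}" "inj_on G (ball z r)"
  using has_complex_derivative_locally_injective[OF G_holomorphic _ open_upper deriv_G_nonzero[OF assms]] assms
  by (auto simp: regular_points_def)

lemma roots_regular_points:
  assumes "\<gamma> \<in> regular_values" "z \<in> roots \<gamma>"
  shows "z \<in> regular_points"
proof -
  have "Im z > 0" using assms roots_upper[of \<gamma> z] by (simp add: regular_values_def)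
  moreover have "G z = \<gamma>" using calculation assms(2) by (simp add: mem_roots_G)
  ultimately show ?thesis using assms(1) by (simp add: regular_points_def)
qed

text \<open>Over a regular value \<open>\<gamma>\<close> there are exactly \<open>card L\<close> points. Choose disjoint discs of equal radius
  about them on which \<open>G\<close> is injective, and let \<open>V\<close> be the intersection of the images of these discs.
  A fibre over a point of \<open>V\<close> has a point in each disc; as it has only \<open>card L\<close> points, it has
  no others. So the discs contain the whole preimage of \<open>V\<close>.\<close>

lemma covering_G: "covering_space regular_points G regular_values"
  unfolding covering_space_def
proof (intro conjI ballI)
  show "continuous_on regular_points G"
    by (rule continuous_on_subset[OF holomorphic_on_imp_continuous_on[OF G_holomorphic]])
      (auto simp: regular_points_def)
  show "G ` regular_points = regular_values"
  proof
    show "regular_values \<subseteq> G ` regular_points"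
    proof
      fix \<gamma> assume \<gamma>: "\<gamma> \<in> regular_values"
      then have "card (roots \<gamma>) > 0" using card_roots_regular card_L_pos by (simp add: regular_values_def)
      then obtain z where z: "z \<in> roots \<gamma>" by (metis card_gt_0_iff ex_in_conv)
      then have "z \<in> regular_points" using \<gamma> roots_regular_points by blast
      moreover have "G z = \<gamma>" using z \<gamma> roots_upper mem_roots_G by (auto simp: regular_values_def)
      ultimately show "\<gamma> \<in> G ` regular_points" by blast
    qed
  qed (auto simp: regular_points_def)
next
  fix \<gamma> assume \<gamma>: "\<gamma> \<in> regular_values"
  have reg: "z \<in> regular_points" if "z \<in> roots \<gamma>" for z
    using that \<gamma> roots_regular_points by blast
  have "\<forall>\<^sub>F r in at_right (0::real). \<forall>z\<in>roots \<gamma>. ball z r \<subseteq> {z. Im z > 0} \<and> inj_on G (ball z r)"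
  proof (intro eventually_ball_finite finite_roots ballI)
    fix z assume "z \<in> roots \<gamma>"
    then obtain r0 where r0: "r0 > 0" "ball z r0 \<subseteq> {z. Im z > 0}" "inj_on G (ball z r0)"
      using G_local_inverse reg by metis
    show "\<forall>\<^sub>F r in at_right 0. ball z r \<subseteq> {z. 0 < Im z} \<and> inj_on G (ball z r)"
      using eventually_at_right_real[OF r0(1)]
    proof eventually_elim
      case (elim r)
      then have "ball z r \<subseteq> ball z r0" by auto
      then show ?case using r0 inj_on_subset by blast
    qed
  qed
  with eventually_disjnt_balls[OF finite_roots[of \<gamma>]] eventually_at_right_less[of 0]
  have small: "\<forall>\<^sub>F r in at_right (0::real). r > 0 \<and>
      (\<forall>z\<in>roots \<gamma>. ball z r \<subseteq> {z. Im z > 0} \<and> inj_on G (ball z r)) \<and>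
      (\<forall>z\<in>roots \<gamma>. \<forall>y\<in>roots \<gamma>. z \<noteq> y \<longrightarrow> disjnt (ball z r) (ball y r))"
    by eventually_elim auto
  from eventually_happens'[OF trivial_limit_at_right_real small] obtain r :: real where r: "r > 0"
      and up: "\<And>z. z \<in> roots \<gamma> \<Longrightarrow> ball z r \<subseteq> {z. Im z > 0}"
      and inj: "\<And>z. z \<in> roots \<gamma> \<Longrightarrow> inj_on G (ball z r)"
      and disj: "\<And>z y. \<lbrakk>z \<in> roots \<gamma>; y \<in> roots \<gamma>; z \<noteq> y\<rbrakk> \<Longrightarrow> disjnt (ball z r) (ball y r)"
    by blast
  have hol: "G holomorphic_on ball z r" if "z \<in> roots \<gamma>" for z
    using G_holomorphic up[OF that] holomorphic_on_subset by blast
  define V where "V = regular_values \<inter> (\<Inter>z\<in>roots \<gamma>. G ` ball z r)"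
  define sheet where "sheet z = ball z r \<inter> G -` V" for z
  have sheet_regular: "sheet z \<subseteq> regular_points" if "z \<in> roots \<gamma>" for z
    using up[OF that] unfolding sheet_def V_def regular_points_def by blast
  have open_V: "open V"
    unfolding V_def
    by (intro open_Int open_INT finite_roots ballI open_regular_values open_mapping_thm3 hol inj open_ball)
  have mem_V: "\<gamma> \<in> V"
  proof -
    have "\<gamma> = G z" if "z \<in> roots \<gamma>" for z
      using that reg[OF that] mem_roots_G[of z] by (simp add: regular_points_def)
    moreover have "z \<in> ball z r" for z :: complex using r by simp
    ultimately show ?thesis using \<gamma> by (fastforce simp: V_def)
  qed
  have openin_V: "openin (top_of_set regular_values) V"
    using open_V by (intro open_subset) (auto simp: V_def)
  have preimage: "\<Union> (sheet ` roots \<gamma>) = regular_points \<inter> G -` V"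
  proof (intro equalityI subsetI)
    fix x assume "x \<in> \<Union> (sheet ` roots \<gamma>)"
    then show "x \<in> regular_points \<inter> G -` V"
      using sheet_regular unfolding sheet_def by blast
  next
    fix x assume x: "x \<in> regular_points \<inter> G -` V"
    have "\<exists>y\<in>ball z r. G y = G x" if "z \<in> roots \<gamma>" for z
    proof -
      have "G x \<in> G ` ball z r" using x that by (auto simp: V_def)
      then show ?thesis by (metis imageE)
    qed
    then obtain y where y: "\<And>z. z \<in> roots \<gamma> \<Longrightarrow> y z \<in> ball z r \<and> G (y z) = G x" by metis
    have "inj_on y (roots \<gamma>)"
      using y disj unfolding inj_on_def disjnt_iff by metis
    then have "card (y ` roots \<gamma>) = card L"
      using \<gamma> card_roots_regular by (simp add: card_image regular_values_def)
    moreover have "card (roots (G x)) = card L"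
      using x card_roots_regular by (simp add: regular_points_def regular_values_def)
    moreover have "y ` roots \<gamma> \<subseteq> roots (G x)"
      using y up mem_roots_G by blast
    ultimately have "y ` roots \<gamma> = roots (G x)" by (intro card_subset_eq finite_roots) auto
    moreover have "x \<in> roots (G x)" using x mem_roots_G by (auto simp: regular_points_def)
    ultimately have "x \<in> y ` roots \<gamma>" by simp
    then obtain z where z: "x = y z" "z \<in> roots \<gamma>" by (rule imageE)
    have "x \<in> ball z r" unfolding z(1) using y[OF z(2)] by (rule conjunct1)
    with x have "x \<in> sheet z" unfolding sheet_def by blast
    then show "x \<in> \<Union> (sheet ` roots \<gamma>)" by (rule UN_I[OF z(2)])
  qed
  have open_sheet: "openin (top_of_set regular_points) u" if u: "u \<in> sheet ` roots \<gamma>" for u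
  proof (rule open_subset)
    from u obtain z where z: "z \<in> roots \<gamma>" "u = sheet z" by blast
    show "u \<subseteq> regular_points" using sheet_regular z by blast
    show "open u" unfolding z(2) sheet_def
      using holomorphic_on_imp_continuous_on[OF hol[OF z(1)]] open_V
      by (intro continuous_open_preimage) auto
  qed
  have disjoint: "pairwise disjnt (sheet ` roots \<gamma>)"
    using disj unfolding pairwise_def sheet_def disjnt_iff by blast
  have homeo: "\<exists>q. homeomorphism u V G q" if u: "u \<in> sheet ` roots \<gamma>" for u
  proof -
    from u obtain z where z: "z \<in> roots \<gamma>" "u = sheet z" by blast
    obtain q where q: "q holomorphic_on G ` ball z r" "\<And>x. x \<in> ball z r \<Longrightarrow> q (G x) = x"
      using holomorphic_has_inverse[OF hol[OF z(1)] open_ball inj[OF z(1)]] by metis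
    have V: "V \<subseteq> G ` ball z r" using z by (auto simp: V_def)
    have "homeomorphism u V G q"
      unfolding homeomorphism_def
    proof (intro conjI ballI)
      show "continuous_on u G"
        by (rule continuous_on_subset[OF holomorphic_on_imp_continuous_on[OF hol[OF z(1)]]])
          (simp add: z sheet_def)
      show "continuous_on V q"
        using holomorphic_on_imp_continuous_on[OF q(1)] V continuous_on_subset by blast
      show Gu: "G ` u = V" using V by (auto simp: z sheet_def)
      have "(\<lambda>x. q (G x)) ` u = (\<lambda>x. x) ` u"
        using q(2) by (intro image_cong) (auto simp: z sheet_def)
      then show "q ` V = u" unfolding Gu[symmetric] image_image by simp
    qed (use q V in \<open>auto simp: z sheet_def\<close>)
    then show ?thesis by blast
  qed
  show "\<exists>T. \<gamma> \<in> T \<and> openin (top_of_set regular_values) T \<and>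
      (\<exists>v. \<Union> v = regular_points \<inter> G -` T \<and> (\<forall>u\<in>v. openin (top_of_set regular_points) u) \<and>
        pairwise disjnt v \<and> (\<forall>u\<in>v. \<exists>q. homeomorphism u T G q))"
    by (rule exI[of _ V], intro conjI exI[of _ "sheet ` roots \<gamma>"] ballI)
      (rule mem_V openin_V preimage disjoint | erule open_sheet homeo)+
qed

text \<open>Near each point, a continuous lift of \<open>f\<close> is \<open>f\<close> followed by a holomorphic local inverse of \<open>G\<close>.\<close>

lemma lift_holomorphic:
  assumes "open U" "continuous_on U g" "g \<in> U \<rightarrow> regular_points" "f holomorphic_on U"
    and "\<And>u. u \<in> U \<Longrightarrow> G (g u) = f u"
  shows "g holomorphic_on U"
proof -
  have "g field_differentiable at u" if u: "u \<in> U" for u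
  proof -
    have "g u \<in> regular_points" using assms(3) u by auto
    then obtain r where r: "r > 0" "ball (g u) r \<subseteq> {z. Im z > 0}" "inj_on G (ball (g u) r)"
      using G_local_inverse by blast
    have holG: "G holomorphic_on ball (g u) r"
      using G_holomorphic r(2) holomorphic_on_subset by blast
    obtain q where q: "q holomorphic_on G ` ball (g u) r" "\<And>x. x \<in> ball (g u) r \<Longrightarrow> q (G x) = x"
      using holomorphic_has_inverse[OF holG open_ball r(3)] by metis
    define M where "M = U \<inter> g -` ball (g u) r"
    have M: "open M" "u \<in> M"
      unfolding M_def using assms(1,2) u r(1) by (auto intro!: continuous_open_preimage)
    have "(q \<circ> f) holomorphic_on M"
    proof (rule holomorphic_on_compose_gen[OF _ q(1)])
      show "f holomorphic_on M" using assms(4) by (rule holomorphic_on_subset) (auto simp: M_def)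
      show "f ` M \<subseteq> G ` ball (g u) r" using assms(5) by (force simp: M_def)
    qed
    then have "g holomorphic_on M"
    proof (rule holomorphic_transform)
      fix v assume v: "v \<in> M"
      then have "q (G (g v)) = g v" using q(2) by (simp add: M_def)
      then show "(q \<circ> f) v = g v" using assms(5) v by (simp add: M_def)
    qed
    then show ?thesis using M by (simp add: holomorphic_on_imp_differentiable_at)
  qed
  then show ?thesis using assms(1) by (simp add: field_differentiable_at_within holomorphic_on_def)
qed

text \<open>Lift \<open>f\<close> from each point of the fibre over a base point. Lifts that agree at one point agree
  everywhere, so the values of the different lifts at \<open>u\<close> are distinct, and by their number they are
  the whole fibre over \<open>f u\<close>.\<close>

lemma root_branches:
  assumes U: "open U" "convex U" "U \<noteq> {}"
    and f: "f holomorphic_on U" "f \<in> U \<rightarrow> regular_values"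
  obtains I :: "complex set" and g :: "complex \<Rightarrow> complex \<Rightarrow> complex"
  where "finite I" "card I = card L" "\<forall>i\<in>I. g i holomorphic_on U"
    "\<forall>u\<in>U. bij_betw (\<lambda>i. g i u) I (roots (f u))"
proof -
  obtain u0 where u0: "u0 \<in> U" using U(3) by blast
  define I where "I = roots (f u0)"
  have card_roots: "card (roots (f u)) = card L" if "u \<in> U" for u
    using f(2) that by (intro card_roots_regular) (auto simp: regular_values_def)
  have contf: "continuous_on U f" using f(1) holomorphic_on_imp_continuous_on by blast
  have "\<exists>h. continuous_on U h \<and> h \<in> U \<rightarrow> regular_points \<and> h u0 = i \<and> (\<forall>u\<in>U. G (h u) = f u)"
    if "i \<in> I" for i
  proof -
    have i: "i \<in> regular_points"
      using f(2) u0 that roots_regular_points by (auto simp: I_def)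
    moreover have "f u0 = G i" using that i mem_roots_G by (auto simp: I_def regular_points_def)
    ultimately show ?thesis
      using covering_space_lift_strong[OF covering_G _ u0 convex_imp_simply_connected[OF U(2)]
          open_imp_locally_path_connected[OF U(1)] contf f(2)] by metis
  qed
  then obtain g where g: "\<And>i. i \<in> I \<Longrightarrow> continuous_on U (g i) \<and> g i \<in> U \<rightarrow> regular_points \<and>
      g i u0 = i \<and> (\<forall>u\<in>U. G (g i u) = f u)"
    by metis
  show thesis
  proof
    show "finite I" by (simp add: I_def finite_roots)
    show "card I = card L" unfolding I_def by (rule card_roots[OF u0])
    show "\<forall>i\<in>I. g i holomorphic_on U"
      using g by (intro ballI lift_holomorphic[OF U(1) _ _ f(1)]) auto
    show "\<forall>u\<in>U. bij_betw (\<lambda>i. g i u) I (roots (f u))"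
    proof
      fix u assume u: "u \<in> U"
      have inj: "inj_on (\<lambda>i. g i u) I"
      proof (rule inj_onI)
        fix i j assume ij: "i \<in> I" "j \<in> I" "g i u = g j u"
        have "g i u0 = g j u0"
          by (rule covering_space_lift_unique[where a = u and T = U, OF covering_G])
            (use g[OF ij(1)] g[OF ij(2)] contf f(2) convex_connected[OF U(2)] u u0 ij(3) in auto)
        then show "i = j" using g ij by metis
      qed
      have "(\<lambda>i. g i u) ` I \<subseteq> roots (f u)"
        using g u mem_roots_G by (fastforce simp: regular_points_def)
      moreover have "card ((\<lambda>i. g i u) ` I) = card (roots (f u))"
        using inj card_roots[OF u] card_roots[OF u0] by (simp add: card_image I_def)
      ultimately have "(\<lambda>i. g i u) ` I = roots (f u)" by (intro card_subset_eq finite_roots)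
      then show "bij_betw (\<lambda>i. g i u) I (roots (f u))" using inj by (simp add: bij_betw_def)
    qed
  qed
qed

end

section \<open>Fibres over values near zero and near infinity\<close>

lemma connected_in_disjoint_open:
  assumes "connected X" "X \<noteq> {}" "\<And>k. k \<in> K \<Longrightarrow> open (D k)"
    and disj: "\<And>j k. \<lbrakk>j \<in> K; k \<in> K; j \<noteq> k\<rbrakk> \<Longrightarrow> disjnt (D j) (D k)"
    and X: "X \<subseteq> (\<Union>k\<in>K. D k)"
  shows "\<exists>k\<in>K. X \<subseteq> D k"
proof -
  obtain k x where k: "k \<in> K" "x \<in> X" "x \<in> D k" using assms(2) X by blast
  define B where "B = (\<Union>j\<in>K - {k}. D j)"
  have "open B" using assms(3) unfolding B_def by blast
  moreover have "X \<subseteq> D k \<union> B" using X unfolding B_def by blast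
  moreover have "D k \<inter> B = {}" using disj k(1) unfolding B_def disjnt_def by blast
  ultimately have "X \<inter> B = {}"
    using connectedD[OF assms(1) assms(3)[OF k(1)], of B] k by blast
  then show ?thesis using \<open>X \<subseteq> D k \<union> B\<close> k(1) by blast
qed

lemma poly_quotient_locally_injective:
  fixes p q :: "complex poly"
  assumes "poly p a = 0" "poly (pderiv p) a \<noteq> 0" "poly q a \<noteq> 0"
  obtains r where "r > 0" "\<And>z. z \<in> ball a r \<Longrightarrow> poly q z \<noteq> 0"
    "inj_on (\<lambda>z. poly p z / poly q z) (ball a r)"
proof -
  define S where "S = {z. poly q z \<noteq> 0}"
  have "q \<noteq> 0" using assms(3) by auto
  then have "open (- {z. poly q z = 0})"
    by (intro open_Compl finite_imp_closed poly_roots_finite)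
  then have S: "open S" "a \<in> S" using assms(3) by (simp_all add: S_def Collect_neg_eq)
  have d: "((\<lambda>z. poly p z / poly q z) has_field_derivative
      (poly (pderiv p) z * poly q z - poly p z * poly (pderiv q) z) / (poly q z * poly q z)) (at z)"
    if "z \<in> S" for z
    using that by (intro DERIV_divide) (auto simp: S_def)
  have "(\<lambda>z. poly p z / poly q z) holomorphic_on S"
    unfolding holomorphic_on_open[OF S(1)] using d by blast
  moreover have "deriv (\<lambda>z. poly p z / poly q z) a \<noteq> 0"
    using DERIV_imp_deriv[OF d[OF S(2)]] assms by simp
  ultimately obtain r where "r > 0" "ball a r \<subseteq> S" "inj_on (\<lambda>z. poly p z / poly q z) (ball a r)"
    using has_complex_derivative_locally_injective[of _ S a] S by metis
  then show thesis using that unfolding S_def by blast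
qed

lemma exp_ln_cis: "t > 0 \<Longrightarrow> exp (of_real (ln t) + \<i> * of_real \<theta>) = of_real t * cis \<theta>"
  by (simp add: exp_add exp_of_real cis_conv_exp)

context herglotz_data
begin

text \<open>Outside the discs of radius \<open>r\<close> about \<open>L\<close> one has \<open>\<bar>F z\<bar> \<le> 1 / r\<close> because the weights have sum \<open>1\<close>,
  so a value \<open>\<gamma> = 1 / F z\<close> has \<open>\<bar>\<gamma>\<bar> \<ge> r\<close>.\<close>

lemma root_near_pole:
  assumes "0 < cmod \<gamma>" "cmod \<gamma> < r" "z \<in> roots \<gamma>"
  shows "\<exists>x\<in>L. z \<in> ball (of_real x) r"
proof (rule ccontr)
  assume "\<not> ?thesis"
  then have far: "r \<le> cmod (z - of_real x)" if "x \<in> L" for x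
    using that by (force simp: dist_norm norm_minus_commute)
  have r: "r > 0" using assms by linarith
  have "cmod (F z) \<le> (\<Sum>x\<in>L. cmod (of_real (w x) / (z - of_real x)))"
    unfolding F_def by (rule norm_sum)
  also have "\<dots> \<le> (\<Sum>x\<in>L. w x / r)"
  proof (rule sum_mono)
    fix x assume x: "x \<in> L"
    have "w x / cmod (z - of_real x) \<le> w x / r"
      using far[OF x] w_pos[OF x] r by (intro divide_left_mono mult_pos_pos) auto
    then show "cmod (of_real (w x) / (z - of_real x)) \<le> w x / r"
      using w_pos[OF x] by (simp add: norm_divide)
  qed
  also have "\<dots> = 1 / r" by (simp add: w_total flip: sum_divide_distrib)
  finally have "cmod \<gamma> * cmod (F z) \<le> cmod \<gamma> * (1 / r)" by (rule mult_left_mono) simp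
  also have "\<dots> < 1" using assms r by simp
  finally have "cmod (\<gamma> * F z) < 1" by (simp add: norm_mult)
  moreover have "\<gamma> * F z = 1" using assms mem_roots_iff[of \<gamma> z] by auto
  ultimately show False by simp
qed

text \<open>\<open>P / Q\<close> has a simple zero at \<open>x\<close>, so it is injective nearby.\<close>

lemma root_unique_near_pole:
  assumes "x \<in> L"
  shows "\<forall>\<^sub>F r in at_right 0. \<forall>\<gamma>. \<forall>z\<in>roots \<gamma> \<inter> ball (of_real x) r. \<forall>y\<in>roots \<gamma> \<inter> ball (of_real x) r. z = y"
proof -
  have "poly P (of_real x) = 0" using assms by (simp add: poly_P_eq_0_iff)
  from poly_quotient_locally_injective[OF this pderiv_P_at_pole[OF assms] poly_Q_at_pole[OF assms]]
  obtain R where R: "R > 0" "\<And>z. z \<in> ball (of_real x) R \<Longrightarrow> poly Q z \<noteq> 0"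
    "inj_on (\<lambda>z. poly P z / poly Q z) (ball (of_real x) R)" by metis
  have "z = y" if "r \<in> {0<..<R}" "z \<in> roots \<gamma> \<inter> ball (of_real x) r" "y \<in> roots \<gamma> \<inter> ball (of_real x) r" for r z y \<gamma>
  proof (rule inj_onD[OF R(3)])
    show b: "z \<in> ball (of_real x) R" "y \<in> ball (of_real x) R" using that by auto
    show "poly P z / poly Q z = poly P y / poly Q y"
      using that R(2)[OF b(1)] R(2)[OF b(2)] by (simp add: roots_def)
  qed
  then show ?thesis
    by (intro eventually_mono[OF eventually_at_right_real[OF R(1)]]) blast
qed

text \<open>\<open>Q / P\<close> has a simple zero at \<open>d\<close>, so it is injective nearby.\<close>

lemma root_unique_near_zero:
  assumes "d \<in> zeros"
  shows "\<forall>\<^sub>F r in at_right 0. \<forall>\<gamma>. \<gamma> \<noteq> 0 \<longrightarrow>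
    (\<forall>z\<in>roots \<gamma> \<inter> ball (of_real d) r. \<forall>y\<in>roots \<gamma> \<inter> ball (of_real d) r. z = y)"
proof -
  have d: "poly Q (of_real d) = 0" using assms by (simp add: zeros_def)
  then have "poly P (of_real d) \<noteq> 0" using poly_P_eq_0_iff poly_Q_at_pole by auto
  from poly_quotient_locally_injective[OF d Q_zero(2)[OF d] this]
  obtain R where R: "R > 0" "\<And>z. z \<in> ball (of_real d) R \<Longrightarrow> poly P z \<noteq> 0"
    "inj_on (\<lambda>z. poly Q z / poly P z) (ball (of_real d) R)" by metis
  have "z = y" if "r \<in> {0<..<R}" "\<gamma> \<noteq> 0" "z \<in> roots \<gamma> \<inter> ball (of_real d) r" "y \<in> roots \<gamma> \<inter> ball (of_real d) r" for r z y \<gamma>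
  proof (rule inj_onD[OF R(3)])
    show b: "z \<in> ball (of_real d) R" "y \<in> ball (of_real d) R" using that by auto
    have "poly P z = \<gamma> * poly Q z" "poly P y = \<gamma> * poly Q y" using that by (simp_all add: roots_def)
    then show "poly Q z / poly P z = poly Q y / poly P y"
      using R(2)[OF b(1)] R(2)[OF b(2)] by (simp add: field_simps)
  qed
  then show ?thesis
    by (intro eventually_mono[OF eventually_at_right_real[OF R(1)]]) blast
qed

text \<open>The function is \<open>1\<close> at \<open>a = b = 0\<close>; the bound \<open>1/8\<close> keeps it in the right half-plane.\<close>

lemma Re_kernel_pos:
  assumes "cmod a \<le> 1/8" "cmod b \<le> 1/8"
  shows "Re (1 / ((1 - a) * (1 - b))) > 0"
proof -
  have "cmod (a + b - a * b) \<le> cmod a + cmod b + cmod a * cmod b"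
    by (metis norm_mult norm_triangle_ineq4 norm_triangle_ineq order_trans add_right_mono)
  also have "\<dots> \<le> 1/8 + 1/8 + 1/8 * (1/8)"
    using assms by (intro add_mono mult_mono) auto
  finally have "cmod (a + b - a * b) < 1" by simp
  then have "Re (a + b - a * b) < 1" using complex_Re_le_cmod[of "a + b - a * b"] by linarith
  moreover have "(1 - a) * (1 - b) = 1 - (a + b - a * b)" by algebra
  ultimately have pos: "Re ((1 - a) * (1 - b)) > 0" by simp
  have "Re (1 / c) > 0" if "Re c > 0" for c
  proof -
    have "c \<noteq> 0" using that by auto
    then have "(Re c)\<^sup>2 + (Im c)\<^sup>2 > 0" using that by (simp add: sum_power2_gt_zero_iff)
    then show ?thesis using that by (simp add: Re_divide)
  qed
  then show ?thesis using pos by blast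
qed

text \<open>For \<open>z\<close> and \<open>y\<close> in one fibre, \<open>0 = F z - F y = (y - z) / (z * y) * K\<close> with
  \<open>K = \<Sum>x\<in>L. w x / ((1 - x / z) * (1 - x / y))\<close>. If \<open>z\<close> and \<open>y\<close> are large compared with \<open>L\<close>, then
  \<open>Re K > 0\<close>, so that \<open>z = y\<close>.\<close>

lemma root_unique_near_infinity:
  "\<forall>\<^sub>F r in at_right 0. \<forall>\<gamma>. \<gamma> \<noteq> 0 \<longrightarrow>
    (\<forall>z\<in>roots \<gamma> \<inter> {z. cmod z > 1 / r}. \<forall>y\<in>roots \<gamma> \<inter> {z. cmod z > 1 / r}. z = y)"
proof -
  have small: "\<forall>\<^sub>F r in at_right (0::real). \<bar>x\<bar> * r \<le> 1/8" for x :: real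
  proof -
    have "((\<lambda>r. \<bar>x\<bar> * r) \<longlongrightarrow> \<bar>x\<bar> * 0) (at_right 0)" by (intro tendsto_intros)
    then have "\<forall>\<^sub>F r in at_right (0::real). \<bar>x\<bar> * r < 1/8"
      by (intro order_tendstoD) auto
    then show ?thesis by eventually_elim simp
  qed
  have "\<forall>\<^sub>F r in at_right (0::real). (\<forall>x\<in>L. \<bar>x\<bar> * r \<le> 1/8) \<and> r > 0"
    using small eventually_at_right_less[of 0]
    by (intro eventually_conj eventually_ball_finite finite_L) auto
  then show ?thesis
  proof (rule eventually_mono, intro allI impI ballI)
    fix r :: real and \<gamma> z y
    assume r: "(\<forall>x\<in>L. \<bar>x\<bar> * r \<le> 1/8) \<and> r > 0" and \<gamma>: "\<gamma> \<noteq> 0"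
      and z: "z \<in> roots \<gamma> \<inter> {z. cmod z > 1 / r}" and y: "y \<in> roots \<gamma> \<inter> {z. cmod z > 1 / r}"
    have zL: "z \<notin> of_real ` L" "y \<notin> of_real ` L" and Feq: "\<gamma> * F z = 1" "\<gamma> * F y = 1"
      using mem_roots_iff[OF \<gamma>] y z by auto
    have big: "cmod u > 0" "\<bar>x\<bar> / cmod u \<le> 1/8" if "cmod u > 1 / r" "x \<in> L" for u x
    proof -
      have "1 / r > 0" using r by simp
      then show u: "cmod u > 0" using that(1) by linarith
      have "\<bar>x\<bar> / cmod u \<le> \<bar>x\<bar> / (1 / r)"
        using that(1) \<open>1 / r > 0\<close> u by (intro divide_left_mono mult_pos_pos) auto
      also have "\<dots> = \<bar>x\<bar> * r" by simp
      also have "\<dots> \<le> 1/8" using r that(2) by blast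
      finally show "\<bar>x\<bar> / cmod u \<le> 1/8" .
    qed
    define K where "K = (\<Sum>x\<in>L. of_real (w x) / ((1 - of_real x / z) * (1 - of_real x / y)))"
    have "Re (of_real (w x) / ((1 - of_real x / z) * (1 - of_real x / y))) > 0" if x: "x \<in> L" for x
    proof -
      have "Re (1 / ((1 - of_real x / z) * (1 - of_real x / y))) > 0"
        using big[of z x] big[of y x] z y x
        by (intro Re_kernel_pos) (auto simp: norm_divide)
      then have "w x * Re (1 / ((1 - of_real x / z) * (1 - of_real x / y))) > 0"
        using w_pos[OF x] by simp
      also have "w x * Re (1 / ((1 - of_real x / z) * (1 - of_real x / y))) =
          Re (of_real (w x) * (1 / ((1 - of_real x / z) * (1 - of_real x / y))))"
        by (simp only: Re_complex_of_real Im_complex_of_real times_complex.sel)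
      finally show ?thesis by simp
    qed
    then have "Re K > 0" unfolding K_def Re_sum by (intro sum_pos finite_L L_nonempty)
    then have K: "K \<noteq> 0" by auto
    obtain x0 where "x0 \<in> L" using L_nonempty by auto
    then have nz: "z \<noteq> 0" "y \<noteq> 0" using big(1)[of z x0] big(1)[of y x0] z y by auto
    have "F z - F y = (\<Sum>x\<in>L. of_real (w x) / (z - of_real x) - of_real (w x) / (y - of_real x))"
      by (simp add: F_def sum_subtractf)
    also have "\<dots> = (\<Sum>x\<in>L. (y - z) / (z * y) * (of_real (w x) / ((1 - of_real x / z) * (1 - of_real x / y))))"
    proof (rule sum.cong)
      fix x assume "x \<in> L"
      then have "z \<noteq> of_real x" "y \<noteq> of_real x" using zL by auto
      moreover have "1 - of_real x / z = (z - of_real x) / z" "1 - of_real x / y = (y - of_real x) / y"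
        using nz by (simp_all add: field_simps)
      ultimately show "of_real (w x) / (z - of_real x) - of_real (w x) / (y - of_real x) =
          (y - z) / (z * y) * (of_real (w x) / ((1 - of_real x / z) * (1 - of_real x / y)))"
        using nz by (simp add: divide_simps) (simp add: algebra_simps)
    qed simp
    also have "\<dots> = (y - z) / (z * y) * K" by (simp only: K_def sum_distrib_left)
    finally have "F z - F y = (y - z) / (z * y) * K" .
    moreover have "F z = F y" using Feq \<gamma> by (metis mult_left_cancel)
    ultimately show "z = y" using K nz by simp
  qed
qed

text \<open>On the disc of radius \<open>1 / r\<close> the polynomial \<open>P\<close> is bounded, and at distance at least \<open>r\<close> from the
  zeros of \<open>Q\<close> one has \<open>\<bar>Q z\<bar> \<ge> r ^ card zeros\<close>. So \<open>P = \<gamma> * Q\<close> is impossible there if \<open>\<gamma>\<close> is large.\<close>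

lemma root_near_zero_or_infinity:
  assumes "r > 0"
  shows "\<exists>M. \<forall>\<gamma> z. cmod \<gamma> > M \<longrightarrow> z \<in> roots \<gamma> \<longrightarrow>
    cmod z > 1 / r \<or> (\<exists>d\<in>zeros. z \<in> ball (of_real d) r)"
proof (intro exI allI impI)
  fix \<gamma> z
  define C where "C = (\<Prod>x\<in>L. 1 / r + \<bar>x\<bar>)"
  assume M: "cmod \<gamma> > C / r ^ card zeros" and z: "z \<in> roots \<gamma>"
  show "cmod z > 1 / r \<or> (\<exists>d\<in>zeros. z \<in> ball (of_real d) r)"
  proof (rule ccontr)
    assume "\<not> ?thesis"
    then have z1: "cmod z \<le> 1 / r" and far: "\<And>d. d \<in> zeros \<Longrightarrow> r \<le> cmod (z - of_real d)"
      by (auto simp: dist_norm norm_minus_commute)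
    have "cmod (poly P z) = (\<Prod>x\<in>L. cmod (z - of_real x))" by (simp add: poly_P prod_norm)
    also have "\<dots> \<le> C" unfolding C_def
    proof (rule prod_mono)
      fix x
      have "cmod (z - of_real x) \<le> cmod z + \<bar>x\<bar>" by (metis norm_of_real norm_triangle_ineq4)
      then show "0 \<le> cmod (z - of_real x) \<and> cmod (z - of_real x) \<le> 1 / r + \<bar>x\<bar>" using z1 by simp
    qed
    finally have P: "cmod (poly P z) \<le> C" .
    have "(\<Prod>d\<in>zeros. r) \<le> (\<Prod>d\<in>zeros. cmod (z - of_real d))"
      using far assms by (intro prod_mono) auto
    then have Q: "r ^ card zeros \<le> cmod (poly Q z)" by (simp add: poly_Q_factor prod_norm)
    have "cmod \<gamma> * r ^ card zeros \<le> cmod \<gamma> * cmod (poly Q z)" using Q by (intro mult_left_mono) auto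
    also have "\<dots> = cmod (poly P z)" using z by (simp add: roots_def norm_mult)
    finally have "cmod \<gamma> * r ^ card zeros \<le> C" using P by linarith
    then show False using M assms by (simp add: field_simps)
  qed
qed

end

section \<open>Branches along rays and their end points\<close>

context herglotz_data
begin

text \<open>For \<open>u\<close> in the strip with \<open>s * Re u\<close> large, the fibre over \<open>exp u\<close> is contained in disjoint open sets
  \<open>D r k\<close>, where \<open>r\<close> may be arbitrarily small. The image of the connected end of the strip under a
  branch lies in one of these sets. Each set contains at most one point of a fibre, so different
  branches belong to different sets; as there are equally many of both, this is a bijection. The sign
  \<open>s\<close> selects the end of the strip: \<open>s = -1\<close> for \<open>\<gamma> \<rightarrow> 0\<close> and \<open>s = 1\<close> for \<open>\<gamma> \<rightarrow> \<infinity>\<close>.\<close>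

lemma branch_endpoints:
  fixes I :: "complex set" and D :: "real \<Rightarrow> 'k \<Rightarrow> complex set" and s :: real
  assumes s: "s * s = 1"
    and J: "convex J" "J \<noteq> {}"
    and cont: "\<And>i. i \<in> I \<Longrightarrow> continuous_on (Im -` J) (g i)"
    and bij: "\<And>u. Im u \<in> J \<Longrightarrow> bij_betw (\<lambda>i. g i u) I (roots (exp u))"
    and K: "finite K" "card K = card I"
    and mono: "\<And>r r' k. \<lbrakk>0 < r; r \<le> r'\<rbrakk> \<Longrightarrow> D r k \<subseteq> D r' k"
    and open_D: "\<And>r k. open (D r k)"
    and \<rho>: "0 < \<rho>" and disj: "\<And>j k. \<lbrakk>j \<in> K; k \<in> K; j \<noteq> k\<rbrakk> \<Longrightarrow> disjnt (D \<rho> j) (D \<rho> k)"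
    and unique: "\<And>k u z y. \<lbrakk>k \<in> K; z \<in> roots (exp u) \<inter> D \<rho> k; y \<in> roots (exp u) \<inter> D \<rho> k\<rbrakk> \<Longrightarrow> z = y"
    and near: "\<And>r. 0 < r \<Longrightarrow> \<exists>B. \<forall>u. B \<le> s * Re u \<longrightarrow> roots (exp u) \<subseteq> (\<Union>k\<in>K. D r k)"
  obtains \<kappa> where "bij_betw \<kappa> I K"
    "\<forall>i\<in>I. \<forall>r>0. \<exists>B. \<forall>u. Im u \<in> J \<longrightarrow> B \<le> s * Re u \<longrightarrow> g i u \<in> D r (\<kappa> i)"
proof -
  obtain B0 where B0: "\<And>u. B0 \<le> s * Re u \<Longrightarrow> roots (exp u) \<subseteq> (\<Union>k\<in>K. D \<rho> k)"
    using near[OF \<rho>] by blast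
  define W where "W = Im -` J \<inter> (\<lambda>u. s * Re u) -` {B0..}"
  have "linear (\<lambda>u. s * Re u)" by (simp add: linear_iff algebra_simps)
  then have "convex W"
    unfolding W_def by (intro convex_Int convex_linear_vimage J(1) bounded_linear.linear[OF bounded_linear_Im] convex_real_interval)
  then have connected_W: "connected W" by (rule convex_connected)
  obtain \<theta> where "\<theta> \<in> J" using J(2) by blast
  then have "Complex (s * B0) \<theta> \<in> W" using s by (simp add: W_def flip: mult.assoc)
  then obtain v where v: "v \<in> W" by blast
  have root: "g i u \<in> roots (exp u)" if "i \<in> I" "Im u \<in> J" for i u
    using bij[OF that(2)] that(1) by (auto simp: bij_betw_def)
  have "\<exists>k\<in>K. g i ` W \<subseteq> D \<rho> k" if i: "i \<in> I" for i
  proof (rule connected_in_disjoint_open)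
    have "continuous_on W (g i)"
      by (rule continuous_on_subset[OF cont[OF i]]) (simp add: W_def)
    then show "connected (g i ` W)" using connected_W by (rule connected_continuous_image)
    show "g i ` W \<noteq> {}" using v by blast
    show "g i ` W \<subseteq> (\<Union>k\<in>K. D \<rho> k)"
    proof
      fix z assume "z \<in> g i ` W"
      then obtain u where u: "u \<in> W" "z = g i u" by blast
      then have "Im u \<in> J" "B0 \<le> s * Re u" by (simp_all add: W_def)
      then show "z \<in> (\<Union>k\<in>K. D \<rho> k)" using root[OF i] B0 u(2) by blast
    qed
  qed (use open_D disj in auto)
  then obtain \<kappa> where \<kappa>: "\<And>i. i \<in> I \<Longrightarrow> \<kappa> i \<in> K" "\<And>i. i \<in> I \<Longrightarrow> g i ` W \<subseteq> D \<rho> (\<kappa> i)"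
    by metis
  have Im_v: "Im v \<in> J" using v by (simp add: W_def)
  have inj: "inj_on \<kappa> I"
  proof (rule inj_onI)
    fix i j assume ij: "i \<in> I" "j \<in> I" "\<kappa> i = \<kappa> j"
    have "g i v = g j v"
    proof (rule unique)
      show "\<kappa> i \<in> K" using \<kappa>(1) ij(1) by blast
      show "g i v \<in> roots (exp v) \<inter> D \<rho> (\<kappa> i)" using root[OF ij(1) Im_v] \<kappa>(2)[OF ij(1)] v by blast
      show "g j v \<in> roots (exp v) \<inter> D \<rho> (\<kappa> i)" using root[OF ij(2) Im_v] \<kappa>(2)[OF ij(2)] v ij(3) by auto
    qed
    then show "i = j" using bij[OF Im_v] ij(1,2) unfolding bij_betw_def inj_on_def by blast
  qed
  have "\<kappa> ` I \<subseteq> K" using \<kappa>(1) by blast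
  moreover have "card (\<kappa> ` I) = card K" using inj K(2) by (simp add: card_image)
  ultimately have "\<kappa> ` I = K" using K(1) by (intro card_subset_eq)
  then have "bij_betw \<kappa> I K" using inj by (simp add: bij_betw_def)
  moreover have "\<exists>B. \<forall>u. Im u \<in> J \<longrightarrow> B \<le> s * Re u \<longrightarrow> g i u \<in> D r (\<kappa> i)" if i: "i \<in> I" and r: "0 < r" for i r
  proof -
    have m: "0 < min r \<rho>" using r \<rho> by simp
    obtain B where B: "\<And>u. B \<le> s * Re u \<Longrightarrow> roots (exp u) \<subseteq> (\<Union>k\<in>K. D (min r \<rho>) k)"
      using near[OF m] by blast
    have "g i u \<in> D r (\<kappa> i)" if u: "Im u \<in> J" "max B B0 \<le> s * Re u" for u
    proof -
      have "g i u \<in> (\<Union>k\<in>K. D (min r \<rho>) k)" using B[of u] u root[OF i u(1)] by auto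
      then obtain k where k: "k \<in> K" "g i u \<in> D (min r \<rho>) k" by blast
      have "g i u \<in> D \<rho> k" using mono[OF m, of \<rho> k] k by auto
      moreover have "g i u \<in> D \<rho> (\<kappa> i)" using \<kappa>(2)[OF i] u by (auto simp: W_def)
      ultimately have "k = \<kappa> i" using disj[of k "\<kappa> i"] k(1) \<kappa>(1)[OF i] by (auto simp: disjnt_iff)
      then show ?thesis using mono[OF m, of r k] k by auto
    qed
    then show ?thesis by blast
  qed
  ultimately show thesis using that by blast
qed

text \<open>Since \<open>P (\<sigma> t) = t * cis \<theta> * Q (\<sigma> t)\<close> with \<open>Q (\<sigma> t) \<noteq> 0\<close>, the point \<open>\<sigma> t\<close> determines \<open>t\<close>, and
  differentiation shows that \<open>\<sigma>' t\<close> does not vanish. Analyticity holds because \<open>\<sigma>\<close> is the restriction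
  of a holomorphic function \<open>k\<close> to the real line.\<close>

lemma simple_analytic_curve_of_branch:
  assumes J: "open J" "\<theta> \<in> J" "J \<subseteq> {0<..<pi}"
    and hol: "h holomorphic_on Im -` J"
    and root: "\<And>u. Im u \<in> J \<Longrightarrow> h u \<in> roots (exp u)"
  shows "simple_analytic_curve (\<lambda>t. h (of_real (ln t) + \<i> * of_real \<theta>))"
proof -
  define \<sigma> where "\<sigma> t = h (of_real (ln t) + \<i> * of_real \<theta>)" for t
  define S where "S = {z. Re z > 0} \<inter> (\<lambda>z. Ln z + \<i> * of_real \<theta>) -` (Im -` J)"
  define k where "k z = h (Ln z + \<i> * of_real \<theta>)" for z
  have \<theta>: "Im (cis \<theta>) > 0" "cis \<theta> \<noteq> 0" using J sin_gt_zero by (auto simp: subset_iff)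
  have nonpos: "z \<notin> \<real>\<^sub>\<le>\<^sub>0" if "Re z > 0" for z using that by (auto simp: complex_nonpos_Reals_iff)
  have Ln_hol: "(\<lambda>z. Ln z + \<i> * of_real \<theta>) holomorphic_on {z. Re z > 0}"
    using nonpos by (intro holomorphic_intros) auto
  have open_S: "open S"
    unfolding S_def
  proof (rule continuous_open_preimage)
    show "continuous_on {z. Re z > 0} (\<lambda>z. Ln z + \<i> * of_real \<theta>)"
      using Ln_hol by (rule holomorphic_on_imp_continuous_on)
    show "open {z. Re z > 0}" by (rule open_halfspace_Re_gt)
    show "open (Im -` J)" using J(1) by (intro open_vimage continuous_intros)
  qed
  have mem_S: "of_real t \<in> S" if "t > 0" for t
    using that J by (simp add: S_def Ln_of_real)
  have \<sigma>k: "\<sigma> t = k (of_real t)" if "t > 0" for t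
    using that by (simp add: \<sigma>_def k_def Ln_of_real)
  have "(h \<circ> (\<lambda>z. Ln z + \<i> * of_real \<theta>)) holomorphic_on S"
    by (rule holomorphic_on_compose_gen[OF holomorphic_on_subset[OF Ln_hol] hol]) (auto simp: S_def)
  then have k_hol: "k holomorphic_on S" by (simp add: k_def[abs_def] comp_def)
  have k_root: "poly P (k z) = z * cis \<theta> * poly Q (k z)" if "z \<in> S" for z
  proof -
    have "z \<noteq> 0" using that by (auto simp: S_def)
    then have "exp (Ln z + \<i> * of_real \<theta>) = z * cis \<theta>" by (simp add: exp_add cis_conv_exp)
    then show ?thesis using root[of "Ln z + \<i> * of_real \<theta>"] that by (simp add: S_def k_def roots_def)
  qed
  have \<sigma>_root: "\<sigma> t \<in> roots (of_real t * cis \<theta>)" if "t > 0" for t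
    using k_root[OF mem_S[OF that]] \<sigma>k[OF that] by (simp add: roots_def)
  have k_deriv: "(k has_field_derivative deriv k z) (at z)" if "z \<in> S" for z
    using k_hol open_S that by (rule holomorphic_derivI)
  have deriv_nz: "deriv k z \<noteq> 0" if z: "z \<in> S" for z
  proof
    assume 0: "deriv k z = 0"
    have "((\<lambda>z. poly P (k z)) has_field_derivative poly (pderiv P) (k z) * deriv k z) (at z)"
      by (rule DERIV_chain2[OF poly_DERIV k_deriv[OF z]])
    then have "((\<lambda>z. z * cis \<theta> * poly Q (k z)) has_field_derivative poly (pderiv P) (k z) * deriv k z) (at z)"
      by (rule has_field_derivative_transform_within_open[OF _ open_S z]) (simp add: k_root)
    moreover have "((\<lambda>z. z * cis \<theta> * poly Q (k z)) has_field_derivative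
        (1 * cis \<theta>) * poly Q (k z) + (poly (pderiv Q) (k z) * deriv k z) * (z * cis \<theta>)) (at z)"
      by (intro DERIV_mult DERIV_chain2[OF poly_DERIV k_deriv[OF z]] DERIV_cmult_right DERIV_ident)
    ultimately have "poly (pderiv P) (k z) * deriv k z =
        (1 * cis \<theta>) * poly Q (k z) + (poly (pderiv Q) (k z) * deriv k z) * (z * cis \<theta>)"
      by (rule DERIV_unique)
    then have "poly Q (k z) = 0" using 0 \<theta> by simp
    moreover have "k z \<in> roots (z * cis \<theta>)" using k_root[OF z] by (simp add: roots_def)
    ultimately show False using roots_Q_nonzero by blast
  qed
  have "real_analytic_on \<sigma> {0<..}"
    unfolding real_analytic_on_def
  proof
    fix t0 :: real assume t0: "t0 \<in> {0<..}"
    then obtain r where r: "r > 0" "ball (of_real t0) r \<subseteq> S"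
      using open_S mem_S open_contains_ball by (metis greaterThan_iff)
    have "(\<lambda>n. (deriv ^^ n) k (of_real t0) / fact n * of_real (t - t0) ^ n) sums \<sigma> t"
      if "t \<in> {0<..}" "\<bar>t - t0\<bar> < r" for t
    proof -
      have "k holomorphic_on ball (of_real t0) r" using k_hol r(2) by (rule holomorphic_on_subset)
      moreover have "complex_of_real t \<in> ball (of_real t0) r"
        using that(2) by (simp add: dist_of_real dist_real_def abs_minus_commute)
      ultimately show ?thesis
        using holomorphic_power_series[of k "of_real t0" r "of_real t"] \<sigma>k that(1) by simp
    qed
    then show "\<exists>a. \<exists>r>0. \<forall>t\<in>{0<..}. \<bar>t - t0\<bar> < r \<longrightarrow> (\<lambda>n. a n * of_real (t - t0) ^ n) sums \<sigma> t"
      using r(1) by (intro exI[of _ "\<lambda>n. (deriv ^^ n) k (of_real t0) / fact n"] exI[of _ r]) blast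
  qed
  moreover have "inj_on \<sigma> {0<..}"
  proof (rule inj_onI)
    fix t s :: real assume ts: "t \<in> {0<..}" "s \<in> {0<..}" "\<sigma> t = \<sigma> s"
    have "poly P (\<sigma> t) = of_real t * cis \<theta> * poly Q (\<sigma> t)"
      using \<sigma>_root[of t] ts(1) by (simp add: roots_def)
    moreover have "poly P (\<sigma> t) = of_real s * cis \<theta> * poly Q (\<sigma> t)"
      using \<sigma>_root[of s] ts(2) unfolding ts(3) by (simp add: roots_def)
    ultimately have "of_real t * cis \<theta> * poly Q (\<sigma> t) = of_real s * cis \<theta> * poly Q (\<sigma> t)"
      by (rule subst)
    moreover have "poly Q (\<sigma> t) \<noteq> 0" using \<sigma>_root[of t] ts roots_Q_nonzero by simp
    ultimately show "t = s" using \<theta> by auto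
  qed
  moreover have "\<sigma> ` {0<..} \<subseteq> {z. Im z > 0}"
  proof safe
    fix t :: real assume t: "t > 0"
    then have "Im (of_real t * cis \<theta>) > 0" using \<theta> by simp
    from roots_upper[OF this \<sigma>_root[OF t]] show "Im (\<sigma> t) > 0" .
  qed
  moreover have "\<forall>t>0. vector_derivative \<sigma> (at t) \<noteq> 0"
  proof (intro allI impI)
    fix t :: real assume t: "t > 0"
    have "((\<lambda>x. k (of_real x)) has_vector_derivative deriv k (of_real t)) (at t)"
      by (rule has_vector_derivative_real_field[OF k_deriv[OF mem_S[OF t]]])
    then have "(\<sigma> has_vector_derivative deriv k (of_real t)) (at t)"
      by (rule has_vector_derivative_transform_within_open[where S = "{0<..}"]) (use t in \<open>auto simp: \<sigma>k\<close>)
    then have "vector_derivative \<sigma> (at t) = deriv k (of_real t)" by (rule vector_derivative_at)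
    then show "vector_derivative \<sigma> (at t) \<noteq> 0" using deriv_nz[OF mem_S[OF t]] by simp
  qed
  ultimately show ?thesis unfolding simple_analytic_curve_def \<sigma>_def[abs_def] by blast
qed

text \<open>Index set, starting points and end points are chosen before \<open>\<theta>\<close>: this is the constancy of the
  permutation on \<open>J\<close>. The end point \<open>None\<close> stands for infinity.\<close>

lemma curves_over_regular_interval:
  assumes J: "open J" "connected J" "J \<noteq> {}" "J \<subseteq> {0<..<pi}"
    and regular: "\<forall>\<theta>\<in>J. \<forall>t>0. of_real t * cis \<theta> \<notin> critical_values"
  obtains I :: "complex set" and \<sigma> :: "real \<Rightarrow> complex \<Rightarrow> real \<Rightarrow> complex"
    and start :: "complex \<Rightarrow> real" and finish :: "complex \<Rightarrow> real option"
  where "bij_betw start I L" "bij_betw finish I (insert None (Some ` zeros))"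
    "\<forall>\<theta>\<in>J. (\<Union>t\<in>{0<..}. roots (of_real t * cis \<theta>)) = (\<Union>i\<in>I. \<sigma> \<theta> i ` {0<..}) \<and>
      disjoint_family_on (\<lambda>i. \<sigma> \<theta> i ` {0<..}) I"
    "\<forall>\<theta>\<in>J. \<forall>i\<in>I. simple_analytic_curve (\<sigma> \<theta> i) \<and> starts_at (\<sigma> \<theta> i) (of_real (start i)) \<and>
      (case finish i of None \<Rightarrow> ends_at_infinity (\<sigma> \<theta> i) | Some d \<Rightarrow> ends_at (\<sigma> \<theta> i) (of_real d))"
proof -
  define U where "U = Im -` J"
  have convex_J: "convex J" using J(2) by (simp add: is_interval_connected_1 flip: is_interval_convex_1)
  have U: "open U" "convex U" "U \<noteq> {}"
  proof -
    show "open U" unfolding U_def using J(1) by (intro open_vimage continuous_intros)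
    show "convex U" unfolding U_def by (intro convex_linear_vimage convex_J bounded_linear.linear[OF bounded_linear_Im])
    obtain \<theta> where "\<theta> \<in> J" using J(3) by blast
    then have "Complex 0 \<theta> \<in> U" by (simp add: U_def)
    then show "U \<noteq> {}" by blast
  qed
  have exp_polar: "exp u = of_real (exp (Re u)) * cis (Im u)" for u by (simp add: exp_eq_polar)
  have exp_regular: "exp \<in> U \<rightarrow> regular_values"
  proof
    fix u assume "u \<in> U"
    then have u: "Im u \<in> J" by (simp add: U_def)
    then have "sin (Im u) > 0" using J(4) sin_gt_zero by (auto simp: subset_iff)
    then have "Im (exp u) > 0" by (simp add: Im_exp)
    moreover have "exp u \<notin> critical_values" using regular u by (simp add: exp_polar)
    ultimately show "exp u \<in> regular_values" by (simp add: regular_values_def)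
  qed
  obtain I :: "complex set" and g :: "complex \<Rightarrow> complex \<Rightarrow> complex"
    where I: "finite I" "card I = card L"
    and hol: "\<forall>i\<in>I. g i holomorphic_on U"
    and bij: "\<forall>u\<in>U. bij_betw (\<lambda>i. g i u) I (roots (exp u))"
    by (rule root_branches[OF U holomorphic_on_exp exp_regular]) (rule that; assumption)
  have cont: "continuous_on (Im -` J) (g i)" if "i \<in> I" for i
    using bspec[OF hol that] unfolding U_def by (rule holomorphic_on_imp_continuous_on)
  have bij': "bij_betw (\<lambda>i. g i u) I (roots (exp u))" if "Im u \<in> J" for u
    using bij that by (simp add: U_def)
  have root: "g i u \<in> roots (exp u)" if "i \<in> I" "Im u \<in> J" for i u
    using bij'[OF that(2)] that(1) by (auto simp: bij_betw_def)
  define \<sigma> where "\<sigma> \<theta> i t = g i (of_real (ln t) + \<i> * of_real \<theta>)" for \<theta> i t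
  have image: "(\<lambda>i. \<sigma> \<theta> i t) ` I = roots (of_real t * cis \<theta>)" and inj: "inj_on (\<lambda>i. \<sigma> \<theta> i t) I"
    if "\<theta> \<in> J" "t > 0" for \<theta> t
    using bij'[of "of_real (ln t) + \<i> * of_real \<theta>"] that
    by (simp_all add: bij_betw_def \<sigma>_def exp_ln_cis)

  \<comment> \<open>A radius for which the discs about \<open>L\<close> are disjoint and each contains at most one root.\<close>
  have "\<forall>\<^sub>F r in at_right 0. (\<forall>x\<in>of_real ` L. \<forall>y\<in>of_real ` L. x \<noteq> y \<longrightarrow> disjnt (ball x r) (ball (y :: complex) r)) \<and>
      (\<forall>x\<in>L. \<forall>\<gamma>. \<forall>z\<in>roots \<gamma> \<inter> ball (of_real x) r. \<forall>y\<in>roots \<gamma> \<inter> ball (of_real x) r. z = y) \<and> r > 0"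
    by (intro eventually_conj eventually_disjnt_balls eventually_ball_finite finite_L finite_imageI
        ballI root_unique_near_pole eventually_at_right_less)
  from eventually_happens'[OF trivial_limit_at_right_real this] obtain r0 :: real where
    r0: "\<forall>x\<in>of_real ` L. \<forall>y\<in>of_real ` L. x \<noteq> y \<longrightarrow> disjnt (ball x r0) (ball (y :: complex) r0)"
    "\<forall>x\<in>L. \<forall>\<gamma>. \<forall>z\<in>roots \<gamma> \<inter> ball (of_real x) r0. \<forall>y\<in>roots \<gamma> \<inter> ball (of_real x) r0. z = y"
    "r0 > 0" by blast
  obtain start where start: "bij_betw start I L"
    "\<forall>i\<in>I. \<forall>r>0. \<exists>B. \<forall>u. Im u \<in> J \<longrightarrow> B \<le> - 1 * Re u \<longrightarrow>
      g i u \<in> ball (of_real (start i)) r"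
  proof (rule branch_endpoints[where s = "-1" and J = J and I = I and g = g and K = L
        and \<rho> = r0 and D = "\<lambda>r x. ball (complex_of_real x) r"])
    show "disjnt (ball (complex_of_real j) r0) (ball (of_real k) r0)" if "j \<in> L" "k \<in> L" "j \<noteq> k" for j k
      using r0(1) that by (metis imageI of_real_eq_iff)
    show "z = y" if "k \<in> L" "z \<in> roots (exp u) \<inter> ball (of_real k) r0" "y \<in> roots (exp u) \<inter> ball (of_real k) r0"
      for k u z y
      using r0(2) that by blast
    show "\<exists>B. \<forall>u. B \<le> - 1 * Re u \<longrightarrow> roots (exp u) \<subseteq> (\<Union>k\<in>L. ball (complex_of_real k) r)" if r: "0 < r" for r
    proof (intro exI[of _ "1 - ln r"] allI impI subsetI)
      fix u z assume u: "1 - ln r \<le> - 1 * Re u" and z: "z \<in> roots (exp u)"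
      have "Re u < ln r" using u by simp
      then have "exp (Re u) < r" using r by (metis exp_less_mono exp_ln)
      then have "cmod (exp u) < r" by simp
      then show "z \<in> (\<Union>k\<in>L. ball (complex_of_real k) r)"
        using root_near_pole[of "exp u" r z] z by simp
    qed
  qed (use convex_J J(3) cont bij' finite_L I(2) r0(3) in auto)

  define D :: "real \<Rightarrow> real option \<Rightarrow> complex set"
    where "D r k = (case k of None \<Rightarrow> {z. cmod z > 1 / r} | Some d \<Rightarrow> ball (of_real d) r)" for r k
  \<comment> \<open>The corresponding choice for the other end, where the neighbourhoods of infinity take part.\<close>
  have "\<forall>\<^sub>F r in at_right 0. disjnt {z. cmod z > 1 / r} (ball (complex_of_real d) r)" for d
  proof -
    have "0 < 1 / (\<bar>d\<bar> + 1)" by simp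
    from eventually_at_right_real[OF this] show ?thesis
    proof eventually_elim
      case (elim r)
      then have rd: "0 < r" "r < 1 / (\<bar>d\<bar> + 1)" by auto
      have "1 / (\<bar>d\<bar> + 1) \<le> 1" by (simp add: divide_le_eq)
      with rd have r: "0 < r" "r < 1" "r < 1 / (\<bar>d\<bar> + 1)" by linarith+
      then have "\<bar>d\<bar> + 1 < 1 / r" by (simp add: field_simps)
      moreover have "cmod z < \<bar>d\<bar> + 1" if "z \<in> ball (of_real d) r" for z
      proof -
        have "cmod z \<le> cmod (of_real d) + cmod (z - of_real d)" by (metis norm_triangle_sub)
        then show ?thesis using that r by (simp add: dist_norm norm_minus_commute)
      qed
      ultimately show ?case by (fastforce simp: disjnt_iff)
    qed
  qed
  then have "\<forall>\<^sub>F r in at_right 0.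
      (\<forall>x\<in>of_real ` zeros. \<forall>y\<in>of_real ` zeros. x \<noteq> y \<longrightarrow> disjnt (ball x r) (ball (y :: complex) r)) \<and>
      (\<forall>d\<in>zeros. disjnt {z. cmod z > 1 / r} (ball (complex_of_real d) r)) \<and>
      (\<forall>d\<in>zeros. \<forall>\<gamma>. \<gamma> \<noteq> 0 \<longrightarrow>
        (\<forall>z\<in>roots \<gamma> \<inter> ball (of_real d) r. \<forall>y\<in>roots \<gamma> \<inter> ball (of_real d) r. z = y)) \<and>
      (\<forall>\<gamma>. \<gamma> \<noteq> 0 \<longrightarrow>
        (\<forall>z\<in>roots \<gamma> \<inter> {z. cmod z > 1 / r}. \<forall>y\<in>roots \<gamma> \<inter> {z. cmod z > 1 / r}. z = y)) \<and> r > 0"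
    by (intro eventually_conj eventually_disjnt_balls eventually_ball_finite finite_zeros finite_imageI
        ballI root_unique_near_zero root_unique_near_infinity eventually_at_right_less)
  from eventually_happens'[OF trivial_limit_at_right_real this] obtain r1 :: real where
    r1: "\<forall>x\<in>of_real ` zeros. \<forall>y\<in>of_real ` zeros. x \<noteq> y \<longrightarrow> disjnt (ball x r1) (ball (y :: complex) r1)"
      "\<forall>d\<in>zeros. disjnt {z. cmod z > 1 / r1} (ball (complex_of_real d) r1)"
      "\<forall>d\<in>zeros. \<forall>\<gamma>. \<gamma> \<noteq> 0 \<longrightarrow>
        (\<forall>z\<in>roots \<gamma> \<inter> ball (of_real d) r1. \<forall>y\<in>roots \<gamma> \<inter> ball (of_real d) r1. z = y)"
      "\<forall>\<gamma>. \<gamma> \<noteq> 0 \<longrightarrow>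
        (\<forall>z\<in>roots \<gamma> \<inter> {z. cmod z > 1 / r1}. \<forall>y\<in>roots \<gamma> \<inter> {z. cmod z > 1 / r1}. z = y)"
      "r1 > 0" by blast
  have card_K: "card (insert None (Some ` zeros)) = card I"
    using card_zeros card_L_pos I(2) finite_zeros by (simp add: card_image)
  obtain finish where finish: "bij_betw finish I (insert None (Some ` zeros))"
    "\<forall>i\<in>I. \<forall>r>0. \<exists>B. \<forall>u. Im u \<in> J \<longrightarrow> B \<le> 1 * Re u \<longrightarrow> g i u \<in> D r (finish i)"
  proof (rule branch_endpoints[where s = 1 and J = J and I = I and g = g and \<rho> = r1 and D = D
        and K = "insert None (Some ` zeros)"])
    show "D r k \<subseteq> D r' k" if "0 < r" "r \<le> r'" for r r' k
    proof (cases k)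
      case None
      have "1 / r' \<le> 1 / r" using that by (simp add: frac_le)
      then show ?thesis by (auto simp: D_def None)
    qed (use that in \<open>auto simp: D_def\<close>)
    show "open (D r k)" for r k
      by (cases k) (auto simp: D_def intro!: open_Collect_less continuous_intros)
    show "disjnt (D r1 j) (D r1 k)"
      if jk: "j \<in> insert None (Some ` zeros)" "k \<in> insert None (Some ` zeros)" "j \<noteq> k" for j k
    proof (cases j)
      case None
      with jk obtain d where "k = Some d" "d \<in> zeros" by auto
      then show ?thesis using None r1(2) by (simp add: D_def)
    next
      case (Some c)
      then have c: "c \<in> zeros" using that by auto
      show ?thesis
      proof (cases k)
        case None
        then show ?thesis using Some c r1(2) by (simp add: D_def disjnt_sym)
      next
        case (Some d)
        then have "d \<in> zeros" "c \<noteq> d" using that \<open>j = Some c\<close> by auto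
        then show ?thesis using Some \<open>j = Some c\<close> c r1(1) by (simp add: D_def)
      qed
    qed
    show "z = y" if "k \<in> insert None (Some ` zeros)" "z \<in> roots (exp u) \<inter> D r1 k" "y \<in> roots (exp u) \<inter> D r1 k"
      for k u z y
    proof (cases k)
      case None
      then show ?thesis using r1(4)[rule_format, OF exp_not_eq_zero, of z u y] that by (simp add: D_def)
    next
      case (Some d)
      then have "d \<in> zeros" using that by auto
      then show ?thesis using r1(3)[rule_format, OF _ exp_not_eq_zero, of d z u y] that Some by (simp add: D_def)
    qed
    show "\<exists>B. \<forall>u. B \<le> 1 * Re u \<longrightarrow> roots (exp u) \<subseteq> (\<Union>k\<in>insert None (Some ` zeros). D r k)" if r: "0 < r" for r
    proof -
      obtain M where M: "\<And>\<gamma> z. \<lbrakk>cmod \<gamma> > M; z \<in> roots \<gamma>\<rbrakk> \<Longrightarrow>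
          cmod z > 1 / r \<or> (\<exists>d\<in>zeros. z \<in> ball (of_real d) r)"
        using root_near_zero_or_infinity[OF r] by blast
      show ?thesis
      proof (intro exI[of _ "ln (max M 1) + 1"] allI impI subsetI)
        fix u z assume u: "ln (max M 1) + 1 \<le> 1 * Re u" and z: "z \<in> roots (exp u)"
        have "exp (ln (max M 1)) < exp (Re u)" using u by (intro exp_less_mono) simp
        then have "M < cmod (exp u)" by simp
        from M[OF this z] show "z \<in> (\<Union>k\<in>insert None (Some ` zeros). D r k)" by (auto simp: D_def)
      qed
    qed
  qed (use convex_J J(3) cont bij' finite_zeros card_K r1(5) in auto)

  show thesis
  proof (rule that[OF start(1) finish(1)]; intro ballI conjI)
    fix \<theta> assume \<theta>: "\<theta> \<in> J"
    show "(\<Union>t\<in>{0<..}. roots (of_real t * cis \<theta>)) = (\<Union>i\<in>I. \<sigma> \<theta> i ` {0<..})"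
    proof -
      have "(\<Union>t\<in>{0<..}. roots (of_real t * cis \<theta>)) = (\<Union>t\<in>{0<..}. (\<lambda>i. \<sigma> \<theta> i t) ` I)"
        using image[OF \<theta>] by simp
      also have "\<dots> = (\<Union>i\<in>I. \<sigma> \<theta> i ` {0<..})" by blast
      finally show ?thesis .
    qed
    show "disjoint_family_on (\<lambda>i. \<sigma> \<theta> i ` {0<..}) I"
      unfolding disjoint_family_on_def
    proof (intro ballI impI equals0I)
      fix i j z assume ij: "i \<in> I" "j \<in> I" "i \<noteq> j" and "z \<in> \<sigma> \<theta> i ` {0<..} \<inter> \<sigma> \<theta> j ` {0<..}"
      then obtain s t where st: "s > 0" "t > 0" "z = \<sigma> \<theta> i s" "z = \<sigma> \<theta> j t" by auto
      have z: "z \<in> roots (of_real s * cis \<theta>)" "z \<in> roots (of_real t * cis \<theta>)"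
        using image[OF \<theta> st(1)] image[OF \<theta> st(2)] ij st(3,4) by blast+
      then have "of_real s * cis \<theta> * poly Q z = of_real t * cis \<theta> * poly Q z" by (simp add: roots_def)
      then have "s = t" using roots_Q_nonzero[OF z(1)] by simp
      then show False using inj[OF \<theta> st(1)] ij st(3,4) by (auto simp: inj_on_def)
    qed
    fix i assume i: "i \<in> I"
    show "simple_analytic_curve (\<sigma> \<theta> i)"
      using simple_analytic_curve_of_branch[OF J(1) \<theta> J(4), of "g i"] bspec[OF hol i] root[OF i]
      by (simp add: \<sigma>_def[abs_def] U_def)
    show "starts_at (\<sigma> \<theta> i) (of_real (start i))"
      unfolding starts_at_def
    proof (rule tendstoI)
      fix \<epsilon> :: real assume \<epsilon>: "\<epsilon> > 0"
      obtain B where B: "\<And>u. \<lbrakk>Im u \<in> J; B \<le> - 1 * Re u\<rbrakk> \<Longrightarrow> g i u \<in> ball (of_real (start i)) \<epsilon>"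
        using start(2)[rule_format, OF i \<epsilon>] by blast
      have "0 < exp (- B)" by simp
      from eventually_at_right_real[OF this]
      show "\<forall>\<^sub>F t in at_right 0. dist (\<sigma> \<theta> i t) (of_real (start i)) < \<epsilon>"
      proof eventually_elim
        case (elim t)
        then have "ln t < ln (exp (- B))" by (subst ln_less_cancel_iff) auto
        then have "B \<le> - ln t" by simp
        then show ?case using B[of "of_real (ln t) + \<i> * of_real \<theta>"] \<theta>
          by (simp add: \<sigma>_def dist_commute)
      qed
    qed
    have finish_tail: "\<forall>\<^sub>F t in at_top. \<sigma> \<theta> i t \<in> D r (finish i)" if r: "r > 0" for r
    proof -
      obtain B where B: "\<And>u. \<lbrakk>Im u \<in> J; B \<le> 1 * Re u\<rbrakk> \<Longrightarrow> g i u \<in> D r (finish i)"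
        using finish(2)[rule_format, OF i r] by blast
      show ?thesis
        using eventually_gt_at_top[of "exp B"]
      proof eventually_elim
        case (elim t)
        then have "t > 0" using exp_gt_zero order_less_trans by blast
        with elim have "ln (exp B) < ln t" by (subst ln_less_cancel_iff) auto
        then have "B \<le> ln t" by simp
        then show ?case using B[of "of_real (ln t) + \<i> * of_real \<theta>"] \<theta>
          by (simp add: \<sigma>_def)
      qed
    qed
    have at_infinity: "ends_at_infinity (\<sigma> \<theta> i)" if "finish i = None"
      unfolding ends_at_infinity_def filterlim_at_top_gt[where c = 0]
    proof (intro allI impI)
      fix Z :: real assume "Z > 0"
      then have "1 / Z > 0" by simp
      from finish_tail[OF this] show "\<forall>\<^sub>F t in at_top. Z \<le> cmod (\<sigma> \<theta> i t)"
        by eventually_elim (simp add: that D_def)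
    qed
    have at_zero: "ends_at (\<sigma> \<theta> i) (of_real d)" if "finish i = Some d" for d
      unfolding ends_at_def
    proof (rule tendstoI)
      fix \<epsilon> :: real assume "\<epsilon> > 0"
      from finish_tail[OF this] show "\<forall>\<^sub>F t in at_top. dist (\<sigma> \<theta> i t) (of_real d) < \<epsilon>"
        by eventually_elim (simp add: that D_def dist_commute)
    qed
    show "case finish i of None \<Rightarrow> ends_at_infinity (\<sigma> \<theta> i) | Some d \<Rightarrow> ends_at (\<sigma> \<theta> i) (of_real d)"
      using at_infinity at_zero by (cases "finish i") auto
  qed
qed

end

section \<open>Spectral decomposition of a cyclic self-adjoint operator\<close>

context finite_dim_hilbert_space
begin

lemma zero_in_H: "0 \<in> H"
  and add_in_H: "\<lbrakk>f \<in> H; g \<in> H\<rbrakk> \<Longrightarrow> f + g \<in> H"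
  and scale_in_H: "f \<in> H \<Longrightarrow> c *\<^sub>C f \<in> H"
  and diff_in_H: "\<lbrakk>f \<in> H; g \<in> H\<rbrakk> \<Longrightarrow> f - g \<in> H"
  and sum_in_H: "(\<And>x. x \<in> S \<Longrightarrow> h x \<in> H) \<Longrightarrow> sum h S \<in> H"
  using subspace_H subspace_0 subspace_add subspace_scale subspace_diff subspace_sum by blast+

lemma ip_zero_left: "g \<in> H \<Longrightarrow> ip 0 g = 0"
  using ip_scale_left[of 0 g 0] zero_in_H by simp

lemma ip_diff_left: "\<lbrakk>f \<in> H; g \<in> H; h \<in> H\<rbrakk> \<Longrightarrow> ip (f - g) h = ip f h - ip g h"
  using ip_add_left[of "f - g" g h] diff_in_H by simp

lemma ip_sum_left:
  assumes "finite S" "\<And>x. x \<in> S \<Longrightarrow> h x \<in> H" "g \<in> H"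
  shows "ip (sum h S) g = (\<Sum>x\<in>S. ip (h x) g)"
  using assms
proof (induction S rule: finite_induct)
  case (insert x S)
  then show ?case using sum_in_H[of S h] by (simp add: ip_add_left)
qed (simp add: ip_zero_left)

lemma ip_scale_right: "\<lbrakk>f \<in> H; g \<in> H\<rbrakk> \<Longrightarrow> ip f (c *\<^sub>C g) = cnj c * ip f g"
  using ip_commute[of f "c *\<^sub>C g"] ip_commute[of f g] scale_in_H[of g c] ip_scale_left[of g f c] by simp

lemma ip_self_real: "f \<in> H \<Longrightarrow> ip f f = of_real (Re (ip f f))"
  using ip_commute[of f f] by (simp add: complex_eq_iff)

lemma ip_self_eq_0: "\<lbrakk>f \<in> H; ip f f = 0\<rbrakk> \<Longrightarrow> f = 0"
  using ip_pos[of f] by auto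

end

context cyclic_self_adjoint
begin

lemma A_in_H: "f \<in> H \<Longrightarrow> A f \<in> H"
  and A_add: "\<lbrakk>f \<in> H; g \<in> H\<rbrakk> \<Longrightarrow> A (f + g) = A f + A g"
  and A_scale: "f \<in> H \<Longrightarrow> A (c *\<^sub>C f) = c *\<^sub>C A f"
  using linear_A by (auto simp: linear_operator_def)

lemma A_zero: "A 0 = 0"
  using A_scale[OF zero_in_H, of 0] by simp

lemma A_sum:
  assumes "finite S" "\<And>x. x \<in> S \<Longrightarrow> h x \<in> H"
  shows "A (sum h S) = (\<Sum>x\<in>S. A (h x))"
  using assms
proof (induction S rule: finite_induct)
  case (insert x S)
  then show ?case using sum_in_H[of S h] by (simp add: A_add)
qed (simp add: A_zero)

lemma ip_A: "\<lbrakk>f \<in> H; g \<in> H\<rbrakk> \<Longrightarrow> ip (A f) g = ip f (A g)"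
  using self_adjoint_A by (simp add: self_adjoint_def)

lemma e_in_H: "e \<in> H"
  using cyclic_e by (simp add: cyclic_vector_def)

lemma e_nonzero: "e \<noteq> 0"
  using unit_e ip_zero_left[OF zero_in_H] by auto

text \<open>\<open>p(A) f\<close>, evaluated by Horner's rule.\<close>

definition act :: "complex poly \<Rightarrow> 'a \<Rightarrow> 'a"
  where "act p f = fold_coeffs (\<lambda>a v. a *\<^sub>C f + A v) p 0"

lemma act_0: "act 0 f = 0"
  by (simp add: act_def)

lemma act_pCons: "act (pCons a p) f = a *\<^sub>C f + A (act p f)"
proof (cases "a = 0 \<and> p = 0")
  case True
  then show ?thesis by (simp add: act_def A_zero)
next
  case False
  then consider "a \<noteq> 0" | "p \<noteq> 0" by blast
  then show ?thesis by cases (simp_all add: act_def)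
qed

lemma act_in_H: "f \<in> H \<Longrightarrow> act p f \<in> H"
  by (induction p) (auto simp: act_0 act_pCons zero_in_H intro: add_in_H scale_in_H A_in_H)

lemma act_add:
  assumes "f \<in> H" shows "act (p + q) f = act p f + act q f"
proof (induction p arbitrary: q)
  case (pCons a p)
  obtain b r where q: "q = pCons b r" by (rule pCons_cases)
  show ?case
    using assms act_in_H[OF assms]
    by (simp add: q act_pCons pCons.IH A_add scale_left_distrib algebra_simps)
qed (simp add: act_0)

lemma act_smult:
  assumes "f \<in> H" shows "act (smult c p) f = c *\<^sub>C act p f"
proof (induction p)
  case (pCons a p)
  then show ?case
    using assms act_in_H[OF assms]
    by (simp add: act_pCons A_scale scale_right_distrib)
qed (simp add: act_0)

lemma act_mult:
  assumes "f \<in> H" shows "act (p * q) f = act p (act q f)"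
proof (induction p)
  case (pCons a p)
  then show ?case
    using act_add[OF assms, of "smult a q" "pCons 0 (p * q)"] act_smult[OF assms, of a q]
    by (simp add: act_pCons mult_pCons_left)
qed (simp add: act_0)

lemma act_1: "act 1 f = f"
  by (simp add: one_pCons act_pCons act_0 A_zero)

lemma act_sum:
  assumes "f \<in> H" "finite S" shows "act (\<Sum>x\<in>S. p x) f = (\<Sum>x\<in>S. act (p x) f)"
  using assms(2) by (induction S rule: finite_induct) (simp_all add: act_0 act_add[OF assms(1)])

lemma act_linear: "f \<in> H \<Longrightarrow> act [:- z, 1:] f = A f - z *\<^sub>C f"
  by (simp add: act_pCons act_0 A_zero)

lemma act_monom: "act (monom 1 n) f = (A ^^ n) f"
proof (induction n)
  case 0
  then show ?case by (simp add: act_1)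
next
  case (Suc n)
  then show ?case by (simp add: monom_Suc act_pCons)
qed

text \<open>The vectors \<open>A\<^sup>n e\<close> lie in a finite-dimensional space, so two of them coincide or they satisfy a
  nontrivial linear relation.\<close>

lemma annihilating_poly: "\<exists>p. p \<noteq> 0 \<and> act p e = 0"
proof -
  define S where "S = range (\<lambda>n. (A ^^ n) e)"
  have "span S = H" using cyclic_e by (simp add: S_def cyclic_vector_def)
  then have SH: "S \<subseteq> H" using span_superset[of S] by simp
  obtain B where B: "finite B" "span B = H" using finite_dim by blast
  show ?thesis
  proof (cases "dependent S")
    case True
    then obtain t c where t: "finite t" "t \<subseteq> S" "(\<Sum>v\<in>t. c v *\<^sub>C v) = 0" and "\<exists>v\<in>t. c v \<noteq> 0"
      unfolding dependent_explicit by blast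
    then obtain v0 where v0: "v0 \<in> t" "c v0 \<noteq> 0" by blast
    have "\<forall>v\<in>t. \<exists>n. (A ^^ n) e = v" using t(2) unfolding S_def by blast
    then obtain ix where ix: "\<And>v. v \<in> t \<Longrightarrow> (A ^^ ix v) e = v" by metis
    define p where "p = (\<Sum>v\<in>t. smult (c v) (monom 1 (ix v)))"
    have "act p e = (\<Sum>v\<in>t. act (smult (c v) (monom 1 (ix v))) e)"
      unfolding p_def by (rule act_sum[OF e_in_H t(1)])
    also have "\<dots> = (\<Sum>v\<in>t. c v *\<^sub>C v)"
      by (intro sum.cong) (simp_all add: act_smult[OF e_in_H] act_monom ix)
    finally have "act p e = 0" using t(3) by simp
    moreover have "coeff p (ix v0) = c v0"
    proof -
      have "ix v = ix v0 \<longleftrightarrow> v = v0" if "v \<in> t" for v using ix that v0(1) by metis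
      then have "coeff p (ix v0) = (\<Sum>v\<in>t. if v = v0 then c v0 else 0)"
        unfolding p_def coeff_sum by (intro sum.cong) (auto simp: coeff_monom)
      then show ?thesis using v0(1) t(1) by simp
    qed
    then have "p \<noteq> 0" using v0(2) by auto
    ultimately show ?thesis by blast
  next
    case False
    then have "finite S" using independent_span_bound[OF B(1)] SH B(2) by blast
    then have "\<not> inj (\<lambda>n. (A ^^ n) e)" unfolding S_def using finite_imageD infinite_UNIV_nat by blast
    then obtain m n where mn: "m \<noteq> n" "(A ^^ m) e = (A ^^ n) e" by (auto simp: inj_on_def)
    define p where "p = monom 1 m + smult (-1) (monom (1::complex) n)"
    have "act p e = (A ^^ m) e + (-1) *\<^sub>C (A ^^ n) e"
      unfolding p_def act_add[OF e_in_H] act_smult[OF e_in_H] act_monom ..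
    then have "act p e = 0" using mn(2) by simp
    moreover have "coeff p m = 1" using mn(1) by (simp add: p_def coeff_monom)
    then have "p \<noteq> 0" by auto
    ultimately show ?thesis by blast
  qed
qed

lemma eigenvalue_real:
  assumes "f \<in> H" "f \<noteq> 0" "A f = z *\<^sub>C f"
  shows "z \<in> \<real>"
proof -
  have "z * ip f f = cnj z * ip f f"
    using ip_A[OF assms(1) assms(1)] ip_scale_left[OF assms(1) assms(1)] ip_scale_right[OF assms(1) assms(1)] assms(3)
    by simp
  moreover have "ip f f \<noteq> 0" using assms ip_self_eq_0 by blast
  ultimately have "z = cnj z" by simp
  then show ?thesis using Reals_cnj_iff by metis
qed

text \<open>Let \<open>p \<noteq> 0\<close> be of least degree with \<open>p(A) e = 0\<close>. If \<open>p = (X - z) * r\<close>, then \<open>v = r(A) e\<close> is nonzero by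
  minimality, so it is an eigenvector for \<open>z\<close>, and \<open>z\<close> is real. If \<open>r\<close> also vanished at \<open>z\<close>, then
  \<open>v = (A - z) f\<close> for some \<open>f\<close>, and \<open>\<langle>v, v\<rangle> = \<langle>f, (A - z) v\<rangle> = 0\<close>. So the roots of \<open>p\<close> are real and
  simple. Lagrange interpolation at the roots writes \<open>1\<close> as a combination of the polynomials \<open>q z\<close>,
  each \<open>p / (X - z)\<close> up to a factor, and thereby \<open>e\<close> as a sum of eigenvectors.\<close>

lemma eigenvector_decomposition:
  obtains L :: "real set" and u :: "real \<Rightarrow> 'a" where "finite L"
    "\<forall>x\<in>L. u x \<in> H \<and> u x \<noteq> 0 \<and> A (u x) = of_real x *\<^sub>C u x" "e = (\<Sum>x\<in>L. u x)"
proof -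
  obtain p where p: "p \<noteq> 0" "act p e = 0"
    and least: "\<And>q. \<lbrakk>q \<noteq> 0; act q e = 0\<rbrakk> \<Longrightarrow> degree p \<le> degree q"
    using ex_has_least_nat[of "\<lambda>p. p \<noteq> 0 \<and> act p e = 0" _ degree] annihilating_poly by metis
  have simple: "z \<in> \<real> \<and> poly (pderiv p) z \<noteq> 0" if z: "poly p z = 0" for z
  proof -
    obtain r where r: "p = [:- z, 1:] * r" using z unfolding poly_eq_0_iff_dvd by (elim dvdE)
    then have r0: "r \<noteq> 0" using p(1) by auto
    have "degree r < degree p" unfolding r using r0 by (subst degree_mult_eq) auto
    then have v0: "act r e \<noteq> 0" using least[OF r0] by force
    define v where "v = act r e"
    have vH: "v \<in> H" unfolding v_def by (rule act_in_H[OF e_in_H])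
    have "act [:- z, 1:] v = 0" unfolding v_def using p(2) act_mult[OF e_in_H, of "[:- z, 1:]" r] r by simp
    then have Av: "A v = z *\<^sub>C v" by (simp add: act_linear[OF vH])
    have real: "z \<in> \<real>" using eigenvalue_real[OF vH _ Av] v0 by (simp add: v_def)
    have "poly r z \<noteq> 0"
    proof
      assume "poly r z = 0"
      then obtain s where s: "r = [:- z, 1:] * s" unfolding poly_eq_0_iff_dvd by (elim dvdE)
      define f where "f = act s e"
      have fH: "f \<in> H" unfolding f_def by (rule act_in_H[OF e_in_H])
      have v: "v = A f - z *\<^sub>C f"
        unfolding v_def s act_mult[OF e_in_H] by (simp add: act_linear fH flip: f_def)
      have "ip v v = ip (A f) v - ip (z *\<^sub>C f) v"
        using ip_diff_left[OF A_in_H[OF fH] scale_in_H[OF fH] vH] v by simp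
      also have "\<dots> = cnj z * ip f v - z * ip f v"
        by (simp add: ip_A[OF fH vH] Av ip_scale_right[OF fH vH] ip_scale_left[OF fH vH])
      also have "\<dots> = 0" using real by (simp add: Reals_cnj_iff)
      finally have "v = 0" using ip_self_eq_0[OF vH] by blast
      then show False using v0 by (simp add: v_def)
    qed
    moreover have "poly (pderiv p) z = poly r z" unfolding r pderiv_mult by (simp add: pderiv_pCons)
    ultimately show ?thesis using real by simp
  qed
  define R where "R = {z. poly p z = 0}"
  have sqf: "rsquarefree p" unfolding rsquarefree_roots using simple by blast
  have finR: "finite R" unfolding R_def by (rule poly_roots_finite[OF p(1)])
  have "(\<Prod>z\<in>R. [:- z, 1:]) = smult (inverse (lead_coeff p)) p"
    using complex_poly_decompose_rsquarefree[OF sqf] p(1) unfolding R_def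
    by (metis leading_coeff_0_iff left_inverse smult_1_left smult_smult)
  then have prod0: "act (\<Prod>z\<in>R. [:- z, 1:]) e = 0"
    using p(2) by (simp add: act_smult[OF e_in_H])
  have degp: "degree p = card R"
  proof -
    have "degree p = degree (smult (lead_coeff p) (\<Prod>z\<in>R. [:- z, 1:]))"
      unfolding R_def by (simp only: complex_poly_decompose_rsquarefree[OF sqf])
    also have "\<dots> = card R" using p(1) by (simp add: degree_prod_eq_sum_degree)
    finally show ?thesis .
  qed
  have "degree p \<noteq> 0"
  proof
    assume "degree p = 0"
    then obtain c where c: "p = [:c:]" by (rule degree_eq_zeroE)
    then have "c *\<^sub>C e = 0" using p(2) by (simp add: act_pCons act_0 A_zero)
    then show False using c p(1) e_nonzero by simp
  qed
  then have card_R: "card R > 0" using degp by simp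
  define q where "q z = (\<Prod>y\<in>R - {z}. [:- y, 1:])" for z
  have q_val: "poly (q z) y = (if y = z then poly (q z) z else 0)" if "y \<in> R" "z \<in> R" for y z
    using that finR by (auto simp: q_def poly_prod intro!: prod_zero)
  have q_nz: "poly (q z) z \<noteq> 0" for z using finR by (auto simp: q_def poly_prod)
  have deg_q: "degree (q z) = card R - 1" if "z \<in> R" for z
    using that finR by (simp add: q_def degree_prod_eq_sum_degree)
  have lagrange: "(\<Sum>z\<in>R. smult (inverse (poly (q z) z)) (q z)) = 1"
  proof (rule poly_eqI_degree)
    fix y assume y: "y \<in> R"
    have "poly (\<Sum>z\<in>R. smult (inverse (poly (q z) z)) (q z)) y = (\<Sum>z\<in>R. inverse (poly (q z) z) * poly (q z) y)"
      by (simp add: poly_sum)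
    also have "\<dots> = (\<Sum>z\<in>R. if z = y then 1 else 0)"
      by (intro sum.cong) (use q_val[OF y] q_nz in \<open>auto simp: left_inverse\<close>)
    also have "\<dots> = 1" using y finR by simp
    finally show "poly (\<Sum>z\<in>R. smult (inverse (poly (q z) z)) (q z)) y = poly 1 y" by simp
  next
    have "degree (\<Sum>z\<in>R. smult (inverse (poly (q z) z)) (q z)) \<le> card R - 1"
      by (rule degree_sum_le[OF finR]) (use deg_q degree_smult_le in \<open>metis\<close>)
    then show "card R > degree (\<Sum>z\<in>R. smult (inverse (poly (q z) z)) (q z))" using card_R by simp
  qed (use card_R in simp)
  define v where "v z = act (smult (inverse (poly (q z) z)) (q z)) e" for z
  have v: "v z \<in> H" "v z \<noteq> 0" "A (v z) = z *\<^sub>C v z" if z: "z \<in> R" for z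
  proof -
    show vH: "v z \<in> H" unfolding v_def by (rule act_in_H[OF e_in_H])
    have "q z \<noteq> 0" using q_nz[of z] by auto
    then have nz: "smult (inverse (poly (q z) z)) (q z) \<noteq> 0" using q_nz[of z] by simp
    have "degree (smult (inverse (poly (q z) z)) (q z)) < degree p"
      using deg_q[OF z] q_nz[of z] degp card_R by simp
    then show "v z \<noteq> 0" unfolding v_def using least[OF nz] by force
    have "act [:- z, 1:] (act (q z) e) = 0"
      using prod0 prod.remove[OF finR z, of "\<lambda>y. [:- y, 1:]"] act_mult[OF e_in_H, of "[:- z, 1:]" "q z"]
      by (simp add: q_def)
    then have "A (act (q z) e) = z *\<^sub>C act (q z) e"
      using act_linear[OF act_in_H[OF e_in_H]] by simp
    then show "A (v z) = z *\<^sub>C v z"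
      by (simp add: v_def act_smult[OF e_in_H] A_scale[OF act_in_H[OF e_in_H]] scale_left_commute)
  qed
  have R_real: "R = of_real ` {x. of_real x \<in> R}"
    using simple unfolding R_def by (auto elim!: Reals_cases)
  have "e = (\<Sum>z\<in>R. v z)"
    using act_sum[OF e_in_H finR, of "\<lambda>z. smult (inverse (poly (q z) z)) (q z)"] lagrange
    by (simp add: v_def act_1)
  also have "\<dots> = (\<Sum>x | of_real x \<in> R. v (of_real x))"
    by (subst R_real, subst sum.reindex) (auto simp: inj_on_def)
  finally have "e = (\<Sum>x | of_real x \<in> R. v (of_real x))" .
  moreover have "finite {x. complex_of_real x \<in> R}"
    using finR R_real by (metis finite_imageD inj_onI of_real_eq_iff)
  ultimately show thesis using that[of "{x. of_real x \<in> R}" "\<lambda>x. v (of_real x)"] v by simp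
qed

end

section \<open>Spectra as fibres\<close>

lemma bij_betw_nth_sorted:
  assumes "finite S"
  shows "bij_betw (\<lambda>k. sorted_list_of_set S ! (k - 1)) {1..card S} (S :: real set)"
proof -
  have "bij_betw (\<lambda>k. k - 1) {1..card S} {..<card S}"
    by (rule bij_betw_byWitness[where f' = Suc]) auto
  moreover have "bij_betw ((!) (sorted_list_of_set S)) {..<card S} S"
    using assms by (intro bij_betw_nth) auto
  ultimately show ?thesis using bij_betw_trans by (fastforce simp: comp_def)
qed

text \<open>The eigenvectors are normalised by the condition that all coordinates of \<open>e\<close> equal \<open>1\<close>. Their
  squared norms are then the weights of the spectral measure of \<open>e\<close>. That they span \<open>H\<close> follows from
  cyclicity.\<close>

locale eigenbasis = cyclic_self_adjoint scale H ip A e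
  for scale :: "complex \<Rightarrow> 'a::ab_group_add \<Rightarrow> 'a"  (infixr "*\<^sub>C" 75)
    and H :: "'a set" and ip :: "'a \<Rightarrow> 'a \<Rightarrow> complex" and A :: "'a \<Rightarrow> 'a" and e :: 'a +
  fixes L :: "real set" and u :: "real \<Rightarrow> 'a"
  assumes finite_spectrum: "finite L"
    and u_in_H: "x \<in> L \<Longrightarrow> u x \<in> H"
    and u_nonzero: "x \<in> L \<Longrightarrow> u x \<noteq> 0"
    and A_u: "x \<in> L \<Longrightarrow> A (u x) = of_real x *\<^sub>C u x"
    and e_eq: "e = (\<Sum>x\<in>L. u x)"
begin

definition weight :: "real \<Rightarrow> real"
  where "weight x = Re (ip (u x) (u x))"

definition comb :: "(real \<Rightarrow> complex) \<Rightarrow> 'a"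
  where "comb a = (\<Sum>x\<in>L. a x *\<^sub>C u x)"

text \<open>The inner product with \<open>e\<close> of the vector with coordinates \<open>a\<close>.\<close>

definition e_coeff :: "(real \<Rightarrow> complex) \<Rightarrow> complex"
  where "e_coeff a = (\<Sum>x\<in>L. a x * of_real (weight x))"

lemma weight_pos: "x \<in> L \<Longrightarrow> weight x > 0"
  using ip_pos[OF u_in_H u_nonzero] by (simp add: weight_def)

lemma ip_u:
  assumes "x \<in> L" "y \<in> L"
  shows "ip (u x) (u y) = (if x = y then of_real (weight x) else 0)"
proof (cases "x = y")
  case True
  then show ?thesis using ip_self_real[OF u_in_H[OF assms(2)]] by (simp add: weight_def)
next
  case False
  have "of_real x * ip (u x) (u y) = of_real y * ip (u x) (u y)"
    using ip_A[OF u_in_H[OF assms(1)] u_in_H[OF assms(2)]] assms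
    by (simp add: A_u u_in_H ip_scale_left ip_scale_right)
  then show ?thesis using False by simp
qed

lemma comb_in_H: "comb a \<in> H"
  unfolding comb_def by (intro sum_in_H scale_in_H u_in_H)

lemma ip_comb_u: "x \<in> L \<Longrightarrow> ip (comb a) (u x) = a x * of_real (weight x)"
  using finite_spectrum
  by (simp add: comb_def ip_sum_left scale_in_H u_in_H ip_scale_left ip_u if_distrib cong: if_cong)

lemma comb_eq_iff: "comb a = comb b \<longleftrightarrow> (\<forall>x\<in>L. a x = b x)"
proof
  assume *: "comb a = comb b"
  show "\<forall>x\<in>L. a x = b x"
  proof
    fix x assume x: "x \<in> L"
    have "a x * of_real (weight x) = b x * of_real (weight x)"
      unfolding ip_comb_u[OF x, symmetric] * ..
    then show "a x = b x" using weight_pos[OF x] by auto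
  qed
qed (auto simp: comb_def intro!: sum.cong)

lemma comb_eq_0_iff: "comb a = 0 \<longleftrightarrow> (\<forall>x\<in>L. a x = 0)"
  using comb_eq_iff[of a "\<lambda>_. 0"] by (simp add: comb_def)

lemma comb_add: "comb a + comb b = comb (\<lambda>x. a x + b x)"
  by (simp add: comb_def scale_left_distrib sum.distrib)

lemma comb_diff: "comb a - comb b = comb (\<lambda>x. a x - b x)"
  by (simp add: comb_def scale_left_diff_distrib sum_subtractf)

lemma comb_scale: "c *\<^sub>C comb a = comb (\<lambda>x. c * a x)"
  by (simp add: comb_def scale_sum_right)

lemma A_comb: "A (comb a) = comb (\<lambda>x. of_real x * a x)"
proof -
  have "A (comb a) = (\<Sum>x\<in>L. A (a x *\<^sub>C u x))"
    unfolding comb_def by (intro A_sum finite_spectrum scale_in_H u_in_H)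
  also have "\<dots> = comb (\<lambda>x. of_real x * a x)"
    unfolding comb_def by (intro sum.cong) (simp_all add: A_scale u_in_H A_u mult.commute)
  finally show ?thesis .
qed

lemma e_comb: "e = comb (\<lambda>_. 1)"
  by (simp add: comb_def e_eq)

lemma ip_comb_e: "ip (comb a) e = e_coeff a"
proof -
  have "ip (u x) e = of_real (weight x)" if x: "x \<in> L" for x
  proof -
    have "ip (u x) e = cnj (ip e (u x))" by (rule ip_commute[OF u_in_H[OF x] e_in_H])
    also have "ip e (u x) = of_real (weight x)" unfolding e_comb ip_comb_u[OF x] by simp
    finally show ?thesis by simp
  qed
  then show ?thesis
    by (simp add: comb_def e_coeff_def ip_sum_left finite_spectrum scale_in_H u_in_H e_in_H ip_scale_left)
qed

lemma weight_total: "sum weight L = 1"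
proof -
  have "ip e e = of_real (sum weight L)" unfolding e_comb ip_comb_e[unfolded e_comb] by (simp add: e_coeff_def)
  then show ?thesis using unit_e by (metis of_real_eq_1_iff)
qed

sublocale pencil: herglotz_data L weight
  by unfold_locales (use finite_spectrum weight_pos weight_total in auto)

lemma inj_u: "inj_on u L"
proof (rule inj_onI)
  fix x y assume xy: "x \<in> L" "y \<in> L" "u x = u y"
  then have "ip (u x) (u y) = of_real (weight x)" using ip_u[of x x] by simp
  then show "x = y" using ip_u[of x y] xy weight_pos[of x] by (auto split: if_splits)
qed

lemma span_u: "span (u ` L) = range comb"
proof -
  have "span (u ` L) = range (\<lambda>c. \<Sum>v\<in>u ` L. c v *\<^sub>C v)"
    using finite_spectrum by (intro span_finite) simp
  also have "\<dots> = range (\<lambda>c. comb (c \<circ> u))"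
    by (simp add: comb_def sum.reindex[OF inj_u])
  also have "\<dots> = range comb"
  proof -
    have "comb a = comb ((a \<circ> inv_into L u) \<circ> u)" for a
      unfolding comb_eq_iff using inj_u by simp
    then show ?thesis by (auto simp: image_iff)
  qed
  finally show ?thesis .
qed

lemma H_eq: "H = range comb"
proof
  have "(A ^^ n) e \<in> range comb" for n
    by (induction n) (auto simp: e_comb A_comb)
  then have "span (range (\<lambda>n. (A ^^ n) e)) \<subseteq> range comb"
    unfolding span_u[symmetric] by (intro span_minimal subspace_span) auto
  then show "H \<subseteq> range comb" using cyclic_e by (simp add: cyclic_vector_def)
qed (use comb_in_H in auto)

lemma obtain_comb:
  assumes "f \<in> H" obtains a where "f = comb a"
  using assms H_eq by auto

lemma N_eq: "N = card L"
proof -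
  have "independent (u ` L)"
  proof
    assume "dependent (u ` L)"
    then obtain c where c: "\<exists>v\<in>u ` L. c v \<noteq> 0" "(\<Sum>v\<in>u ` L. c v *\<^sub>C v) = 0"
      using finite_spectrum by (subst (asm) dependent_finite) auto
    then have "comb (c \<circ> u) = 0" by (simp add: comb_def sum.reindex[OF inj_u])
    then show False using c(1) by (auto simp: comb_eq_0_iff)
  qed
  moreover have "span (u ` L) = span H"
    unfolding span_u H_eq[symmetric] using subspace_H by (metis span_eq_iff)
  ultimately have "dim H = card (u ` L)" by (intro dim_eq_card)
  then show ?thesis by (simp add: N_def card_image inj_u)
qed

lemma perturbed_comb:
  "perturbed \<gamma> (comb a) - z *\<^sub>C comb a = comb (\<lambda>x. (of_real x - z) * a x + \<gamma> * e_coeff a)"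
proof -
  have "perturbed \<gamma> (comb a) = comb (\<lambda>x. of_real x * a x) + (\<gamma> * e_coeff a) *\<^sub>C comb (\<lambda>_. 1)"
    by (simp add: perturbed_def A_comb ip_comb_e flip: e_comb)
  then show ?thesis by (simp add: comb_scale comb_add comb_diff algebra_simps)
qed

lemma e_coeff_kernel:
  assumes "z \<notin> of_real ` L"
  shows "e_coeff (\<lambda>x. 1 / (z - of_real x)) = pencil.F z"
  by (simp add: e_coeff_def pencil.F_def)

text \<open>The equation \<open>(A\<^sub>\<gamma> - z) f = g\<close> in coordinates: solvability and uniqueness. Given \<open>s = \<langle>f, e\<rangle>\<close>, the
  equations for the single coordinates are independent of each other. If \<open>z\<close> is not an eigenvalue
  of \<open>A\<close>, then \<open>s\<close> is determined by a scalar equation with coefficient \<open>1 - \<gamma> * F z\<close>. If it is, then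
  the equation for the coordinate \<open>z\<close> determines \<open>s\<close>, and \<open>s\<close> in turn determines this coordinate.\<close>

lemma pencil_solvable:
  assumes "\<gamma> \<noteq> 0" "z \<notin> pencil.roots \<gamma>"
  shows "\<exists>a. \<forall>x\<in>L. (of_real x - z) * a x + \<gamma> * e_coeff a = b x"
    and "\<forall>x\<in>L. (of_real x - z) * a x + \<gamma> * e_coeff a = 0 \<Longrightarrow> x \<in> L \<Longrightarrow> a x = 0"
proof -
  have "(\<exists>a. \<forall>x\<in>L. (of_real x - z) * a x + \<gamma> * e_coeff a = b x) \<and>
    ((\<forall>x\<in>L. (of_real x - z) * a x + \<gamma> * e_coeff a = 0) \<longrightarrow> (\<forall>x\<in>L. a x = 0))"
  proof (cases "z \<in> of_real ` L")
    case True
    then obtain m where m: "m \<in> L" "z = of_real m" by blast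
    have split: "e_coeff a = a m * of_real (weight m) + (\<Sum>x\<in>L - {m}. a x * of_real (weight x))" for a
      unfolding e_coeff_def by (rule sum.remove[OF finite_spectrum m(1)])
    define a0 where "a0 x = (b x - b m) / (of_real x - z)" for x
    define a1 where "a1 = (\<lambda>x. if x = m then (b m / \<gamma> - (\<Sum>x\<in>L - {m}. a0 x * of_real (weight x))) / of_real (weight m) else a0 x)"
    have "(\<Sum>x\<in>L - {m}. a1 x * of_real (weight x)) = (\<Sum>x\<in>L - {m}. a0 x * of_real (weight x))"
      by (intro sum.cong) (auto simp: a1_def)
    then have "e_coeff a1 = b m / \<gamma>"
      using weight_pos[OF m(1)] unfolding split by (simp add: a1_def)
    then have "\<forall>x\<in>L. (of_real x - z) * a1 x + \<gamma> * e_coeff a1 = b x"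
      using assms(1) by (auto simp: a1_def a0_def m(2))
    moreover have "\<forall>x\<in>L. a x = 0" if *: "\<forall>x\<in>L. (of_real x - z) * a x + \<gamma> * e_coeff a = 0"
    proof -
      have e0: "e_coeff a = 0" using bspec[OF * m(1)] assms(1) m(2) by simp
      have off: "a x = 0" if "x \<in> L" "x \<noteq> m" for x
        using bspec[OF * that(1)] e0 that(2) m(2) by simp
      then have "(\<Sum>x\<in>L - {m}. a x * of_real (weight x)) = 0" by (intro sum.neutral) auto
      then have "a m = 0" using e0 weight_pos[OF m(1)] unfolding split by simp
      then show ?thesis using off by blast
    qed
    ultimately show ?thesis by blast
  next
    case False
    then have nz: "of_real x - z \<noteq> 0" if "x \<in> L" for x using that by auto
    have F: "\<gamma> * pencil.F z \<noteq> 1" using assms False pencil.mem_roots_iff by blast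
    define s where "s = (\<Sum>x\<in>L. b x / (of_real x - z) * of_real (weight x)) / (1 - \<gamma> * pencil.F z)"
    define a1 where "a1 x = (b x - \<gamma> * s) / (of_real x - z)" for x
    have FK: "(\<Sum>x\<in>L. of_real (weight x) / (of_real x - z)) = - pencil.F z"
      unfolding pencil.F_def sum_negf[symmetric]
      by (intro sum.cong) (auto simp: minus_divide_right)
    have "e_coeff a1 = (\<Sum>x\<in>L. b x / (of_real x - z) * of_real (weight x) - \<gamma> * s * (of_real (weight x) / (of_real x - z)))"
      unfolding e_coeff_def a1_def by (intro sum.cong) (simp_all add: diff_divide_distrib left_diff_distrib)
    also have "\<dots> = (\<Sum>x\<in>L. b x / (of_real x - z) * of_real (weight x)) + \<gamma> * s * pencil.F z"
      by (simp only: sum_subtractf FK flip: sum_distrib_left) simp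
    also have "\<dots> = s * (1 - \<gamma> * pencil.F z) + \<gamma> * s * pencil.F z"
      using F by (simp add: s_def)
    finally have "e_coeff a1 = s" by (simp add: algebra_simps)
    then have "\<forall>x\<in>L. (of_real x - z) * a1 x + \<gamma> * e_coeff a1 = b x"
      using nz by (simp add: a1_def)
    moreover have "\<forall>x\<in>L. a x = 0" if *: "\<forall>x\<in>L. (of_real x - z) * a x + \<gamma> * e_coeff a = 0"
    proof -
      have a: "a x = - (\<gamma> * e_coeff a) / (of_real x - z)" if "x \<in> L" for x
        using bspec[OF * that] nz[OF that] by (simp add: field_simps add_eq_0_iff)
      have "e_coeff a = (\<Sum>x\<in>L. - (\<gamma> * e_coeff a) * (of_real (weight x) / (of_real x - z)))"
        unfolding e_coeff_def[of a] by (intro sum.cong refl) (simp add: a e_coeff_def)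
      also have "\<dots> = \<gamma> * e_coeff a * pencil.F z"
        by (simp only: FK flip: sum_distrib_left) simp
      finally have "e_coeff a * (1 - \<gamma> * pencil.F z) = 0" by (simp add: algebra_simps)
      then have "e_coeff a = 0" using F by simp
      then show ?thesis using a by simp
    qed
    ultimately show ?thesis by blast
  qed
  then show "\<exists>a. \<forall>x\<in>L. (of_real x - z) * a x + \<gamma> * e_coeff a = b x"
    and "\<forall>x\<in>L. (of_real x - z) * a x + \<gamma> * e_coeff a = 0 \<Longrightarrow> x \<in> L \<Longrightarrow> a x = 0" by blast+
qed

text \<open>If \<open>\<gamma> * F z = 1\<close>, then the vector with coordinates \<open>1 / (z - x)\<close>, the resolvent of \<open>A\<close> applied
  to \<open>e\<close>, is an eigenvector of \<open>A\<^sub>\<gamma>\<close>.\<close>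

lemma Spec_perturbed:
  assumes \<gamma>: "\<gamma> \<noteq> 0"
  shows "Spec (perturbed \<gamma>) = pencil.roots \<gamma>"
proof -
  have "\<not> bij_betw (\<lambda>f. perturbed \<gamma> f - z *\<^sub>C f) H H \<longleftrightarrow> z \<in> pencil.roots \<gamma>" for z
  proof
    assume z: "z \<in> pencil.roots \<gamma>"
    then have zL: "z \<notin> of_real ` L" and F: "\<gamma> * pencil.F z = 1"
      using pencil.mem_roots_iff[OF \<gamma>] by auto
    define k where "k x = 1 / (z - of_real x)" for x
    have e_k: "e_coeff k = pencil.F z" unfolding k_def by (rule e_coeff_kernel[OF zL])
    have "(of_real x - z) * k x + \<gamma> * e_coeff k = 0" if "x \<in> L" for x
    proof -
      have "z - of_real x \<noteq> 0" using zL that by auto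
      then have "(of_real x - z) * k x = - 1" by (simp add: k_def field_simps)
      then show ?thesis using e_k F by simp
    qed
    then have "perturbed \<gamma> (comb k) - z *\<^sub>C comb k = 0"
      unfolding perturbed_comb comb_eq_0_iff by blast
    moreover have "perturbed \<gamma> (comb (\<lambda>_. 0)) - z *\<^sub>C comb (\<lambda>_. 0) = 0"
      unfolding perturbed_comb comb_eq_0_iff by (simp add: e_coeff_def)
    moreover have "comb k \<noteq> comb (\<lambda>_. 0)"
      using pencil.L_nonempty zL by (auto simp: comb_eq_iff k_def)
    ultimately show "\<not> bij_betw (\<lambda>f. perturbed \<gamma> f - z *\<^sub>C f) H H"
      using comb_in_H unfolding bij_betw_def inj_on_def by metis
  next
    have "bij_betw (\<lambda>f. perturbed \<gamma> f - z *\<^sub>C f) H H" if z: "z \<notin> pencil.roots \<gamma>"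
      unfolding bij_betw_def
    proof
      show "inj_on (\<lambda>f. perturbed \<gamma> f - z *\<^sub>C f) H"
      proof (rule inj_onI)
        fix f g assume fg: "f \<in> H" "g \<in> H" "perturbed \<gamma> f - z *\<^sub>C f = perturbed \<gamma> g - z *\<^sub>C g"
        obtain a where f: "f = comb a" using fg(1) by (rule obtain_comb)
        obtain b where g: "g = comb b" using fg(2) by (rule obtain_comb)
        have "\<forall>x\<in>L. (of_real x - z) * a x + \<gamma> * e_coeff a = (of_real x - z) * b x + \<gamma> * e_coeff b"
          using fg(3) unfolding f g perturbed_comb comb_eq_iff .
        moreover have diff: "e_coeff (\<lambda>x. a x - b x) = e_coeff a - e_coeff b"
          by (simp add: e_coeff_def sum_subtractf left_diff_distrib)
        ultimately have "\<forall>x\<in>L. (of_real x - z) * (a x - b x) + \<gamma> * e_coeff (\<lambda>x. a x - b x) = 0"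
          unfolding diff by (simp add: algebra_simps)
        from pencil_solvable(2)[OF \<gamma> z this] show "f = g" unfolding f g comb_eq_iff by simp
      qed
      show "(\<lambda>f. perturbed \<gamma> f - z *\<^sub>C f) ` H = H"
      proof
        show "(\<lambda>f. perturbed \<gamma> f - z *\<^sub>C f) ` H \<subseteq> H"
        proof
          fix h assume "h \<in> (\<lambda>f. perturbed \<gamma> f - z *\<^sub>C f) ` H"
          then obtain f where f: "f \<in> H" "h = perturbed \<gamma> f - z *\<^sub>C f" by blast
          obtain a where "f = comb a" using f(1) by (rule obtain_comb)
          then show "h \<in> H" unfolding f(2) by (simp only: perturbed_comb comb_in_H)
        qed
        show "H \<subseteq> (\<lambda>f. perturbed \<gamma> f - z *\<^sub>C f) ` H"
        proof
          fix h assume "h \<in> H"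
          then obtain b where h: "h = comb b" by (rule obtain_comb)
          obtain a where "\<forall>x\<in>L. (of_real x - z) * a x + \<gamma> * e_coeff a = b x"
            using pencil_solvable(1)[OF \<gamma> z] by blast
          then have "perturbed \<gamma> (comb a) - z *\<^sub>C comb a = h" unfolding h perturbed_comb comb_eq_iff .
          then show "h \<in> (\<lambda>f. perturbed \<gamma> f - z *\<^sub>C f) ` H" using comb_in_H by blast
        qed
      qed
    qed
    then show "\<not> bij_betw (\<lambda>f. perturbed \<gamma> f - z *\<^sub>C f) H H \<Longrightarrow> z \<in> pencil.roots \<gamma>" by blast
  qed
  then show ?thesis by (simp add: Spec_def)
qed

lemma eigenvalues_A: "{x. of_real x \<in> eigenvalues H A} = L"
proof (intro equalityI subsetI)
  fix x assume "x \<in> {x. complex_of_real x \<in> eigenvalues H A}"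
  then obtain f where f: "f \<in> H" "f \<noteq> 0" "A f = of_real x *\<^sub>C f" by (auto simp: eigenvalues_def)
  obtain a where a: "f = comb a" using f(1) by (rule obtain_comb)
  obtain y where y: "y \<in> L" "a y \<noteq> 0" using f(2) unfolding a comb_eq_0_iff by blast
  have "of_real y * a y = of_real x * a y" using f(3) y(1) unfolding a A_comb comb_scale comb_eq_iff by blast
  then show "x \<in> L" using y by simp
next
  fix x assume "x \<in> L"
  then show "x \<in> {x. complex_of_real x \<in> eigenvalues H A}"
    using u_in_H u_nonzero A_u by (auto simp: eigenvalues_def)
qed

lemma projection_complement_e:
  assumes f: "f \<in> H"
  shows "orthogonal_projection complement_e f = f - ip f e *\<^sub>C e"
  unfolding orthogonal_projection_def
proof (rule the_equality)
  have in_K: "f - ip f e *\<^sub>C e \<in> complement_e"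
    using f e_in_H scale_in_H diff_in_H
    by (simp add: complement_e_def ip_diff_left ip_scale_left unit_e)
  have ip_e_K: "ip e k = 0" if "k \<in> complement_e" for k
    using that ip_commute[of e k] e_in_H by (simp add: complement_e_def)
  show "f - ip f e *\<^sub>C e \<in> complement_e \<and> (\<forall>k\<in>complement_e. ip (f - (f - ip f e *\<^sub>C e)) k = 0)"
    using in_K ip_e_K e_in_H by (simp add: ip_scale_left complement_e_def)
  fix g assume g: "g \<in> complement_e \<and> (\<forall>k\<in>complement_e. ip (f - g) k = 0)"
  have gH: "g \<in> H" using g by (simp add: complement_e_def)
  define h where "h = f - g - ip f e *\<^sub>C e"
  have hH: "h \<in> H" unfolding h_def by (intro diff_in_H f gH scale_in_H e_in_H)
  have h_K: "h \<in> complement_e"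
    using g hH f gH e_in_H scale_in_H diff_in_H
    by (simp add: complement_e_def h_def ip_diff_left ip_scale_left unit_e)
  have "ip h h = ip (f - g) h - ip (ip f e *\<^sub>C e) h"
    using ip_diff_left[of "f - g" "ip f e *\<^sub>C e" h] hH f gH e_in_H scale_in_H diff_in_H by (simp add: h_def)
  also have "\<dots> = 0"
    using g h_K ip_e_K[OF h_K] hH e_in_H by (simp add: ip_scale_left)
  finally have "h = 0" using ip_self_eq_0[OF hH] by blast
  then show "g = f - ip f e *\<^sub>C e" by (simp add: h_def algebra_simps)
qed

lemma truncation_comb:
  assumes "f \<in> complement_e"
  shows "truncation A complement_e f = A f - ip (A f) e *\<^sub>C e"
proof -
  have f: "f \<in> H" "ip f e = 0" using assms by (auto simp: complement_e_def)
  then show ?thesis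
    by (simp add: truncation_def projection_complement_e[OF f(1)] projection_complement_e[OF A_in_H[OF f(1)]])
qed

text \<open>An eigenvector \<open>f \<bottom> e\<close> of the truncation satisfies \<open>(A - z) f = c * e\<close> with \<open>c = \<langle>A f, e\<rangle>\<close>, so it is a
  multiple of the resolvent applied to \<open>e\<close>, and orthogonality to \<open>e\<close> means \<open>F z = 0\<close>.\<close>

lemma eigenvalues_truncation:
  "{x. of_real x \<in> eigenvalues complement_e (truncation A complement_e)} = pencil.zeros"
proof (intro equalityI subsetI)
  fix z assume "z \<in> {x. complex_of_real x \<in> eigenvalues complement_e (truncation A complement_e)}"
  then obtain f where f: "f \<in> complement_e" "f \<noteq> 0"
    "truncation A complement_e f = of_real z *\<^sub>C f" by (auto simp: eigenvalues_def)
  have fH: "f \<in> H" "ip f e = 0" using f(1) by (auto simp: complement_e_def)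
  obtain a where a: "f = comb a" using fH(1) by (rule obtain_comb)
  define c where "c = ip (A f) e"
  have "comb (\<lambda>x. of_real x * a x - c * 1) = A f - c *\<^sub>C e"
    by (simp only: a A_comb e_comb comb_scale comb_diff)
  also have "\<dots> = of_real z *\<^sub>C f"
    using f(3) unfolding truncation_comb[OF f(1)] c_def .
  finally have "comb (\<lambda>x. of_real x * a x - c * 1) = comb (\<lambda>x. of_real z * a x)"
    by (simp only: a comb_scale)
  then have eq: "(of_real x - of_real z) * a x = c" if "x \<in> L" for x
    using that unfolding comb_eq_iff by (auto simp: algebra_simps)
  have sum0: "e_coeff a = 0" using fH(2) unfolding a ip_comb_e .
  have zL: "z \<notin> L"
  proof
    assume z: "z \<in> L"
    then have "c = 0" using eq[OF z] by simp
    then have off: "a x = 0" if "x \<in> L" "x \<noteq> z" for x using eq[OF that(1)] that(2) by simp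
    have "e_coeff a = a z * of_real (weight z) + (\<Sum>x\<in>L - {z}. a x * of_real (weight x))"
      unfolding e_coeff_def by (rule sum.remove[OF finite_spectrum z])
    also have "(\<Sum>x\<in>L - {z}. a x * of_real (weight x)) = 0" using off by (intro sum.neutral) auto
    finally have "a z = 0" using sum0 weight_pos[OF z] by simp
    then have "f = 0" unfolding a comb_eq_0_iff using off by blast
    then show False using f(2) by blast
  qed
  then have zL': "complex_of_real z \<notin> of_real ` L" by auto
  have ax: "a x = - c * (1 / (of_real z - of_real x))" if "x \<in> L" for x
  proof -
    have "complex_of_real z - of_real x \<noteq> 0" using zL that by auto
    then show ?thesis using eq[OF that] by (simp add: field_simps)
  qed
  have "e_coeff a = - c * e_coeff (\<lambda>x. 1 / (of_real z - of_real x))"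
    unfolding e_coeff_def sum_distrib_left by (intro sum.cong) (simp_all add: ax)
  then have "c * pencil.F (of_real z) = 0" using sum0 e_coeff_kernel[OF zL'] by simp
  moreover have "c \<noteq> 0"
  proof
    assume "c = 0"
    then have "f = 0" unfolding a comb_eq_0_iff using ax by simp
    then show False using f(2) by blast
  qed
  ultimately have "pencil.F (of_real z) = 0" by simp
  then show "z \<in> pencil.zeros" using pencil.poly_Q_eq[OF zL'] by (simp add: pencil.zeros_def)
next
  fix z assume z: "z \<in> pencil.zeros"
  then have zL: "complex_of_real z \<notin> of_real ` L" using pencil.poly_Q_at_pole by (auto simp: pencil.zeros_def)
  then have F: "pencil.F (of_real z) = 0"
    using z pencil.poly_Q_eq[OF zL] pencil.poly_P_eq_0_iff by (simp add: pencil.zeros_def)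
  define a where "a x = 1 / (complex_of_real z - of_real x)" for x
  have e_a: "e_coeff a = 0" unfolding a_def e_coeff_kernel[OF zL] by (rule F)
  then have K: "comb a \<in> complement_e" using comb_in_H by (simp add: complement_e_def ip_comb_e)
  have nz: "complex_of_real z - of_real x \<noteq> 0" if "x \<in> L" for x using zL that by auto
  have "A (comb a) = comb (\<lambda>x. of_real z * a x + (- 1) * 1)"
    unfolding A_comb comb_eq_iff using nz by (simp add: a_def field_simps)
  also have "\<dots> = of_real z *\<^sub>C comb a + (-1) *\<^sub>C e"
    unfolding e_comb comb_scale comb_add ..
  finally have Aa: "A (comb a) = of_real z *\<^sub>C comb a + (-1) *\<^sub>C e" .
  have "ip (A (comb a)) e = - 1"
    unfolding Aa using comb_in_H e_in_H scale_in_H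
    by (simp add: ip_add_left ip_scale_left ip_comb_e e_a unit_e del: scale_minus_left scale_one)
  then have "truncation A complement_e (comb a) = of_real z *\<^sub>C comb a"
    unfolding truncation_comb[OF K] by (simp add: Aa)
  moreover have "comb a \<noteq> 0"
    using pencil.L_nonempty nz by (auto simp: comb_eq_0_iff a_def)
  ultimately show "z \<in> {x. complex_of_real x \<in> eigenvalues complement_e (truncation A complement_e)}"
    using K by (auto simp: eigenvalues_def)
qed

lemma lam_bij: "bij_betw lam {1..N} L"
  using bij_betw_nth_sorted[OF finite_spectrum]
  by (simp add: lam_def[abs_def] ordered_eigenvalue_def eigenvalues_A N_eq)

lemma delta_bij: "bij_betw delta {1..N - 1} pencil.zeros"
  using bij_betw_nth_sorted[OF pencil.finite_zeros]
  by (simp add: delta_def[abs_def] ordered_eigenvalue_def eigenvalues_truncation N_eq pencil.card_zeros)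

lemma spectral_curve_eq: "spectral_curve \<theta> = (\<Union>t\<in>{0<..}. pencil.roots (of_real t * cis \<theta>))"
  by (simp add: spectral_curve_def Spec_perturbed)

definition exceptional_angles :: "real set"
  where "exceptional_angles = Arg ` pencil.critical_values"

text \<open>The branches are indexed by fibre points. Renumber them by the rank of their starting point in
  \<open>L\<close>; the permutation is then the rank of the end point, where infinity has rank \<open>N\<close>.\<close>

lemma permutation_over_regular_interval:
  assumes J: "open J" "connected J" "J \<noteq> {}" "J \<subseteq> {0<..<pi} - exceptional_angles"
  shows "\<exists>p. \<forall>\<theta>\<in>J. curves_with_permutation \<theta> p"
proof -
  have J': "J \<subseteq> {0<..<pi}" using J(4) by blast
  have regular: "\<forall>\<theta>\<in>J. \<forall>t>0. of_real t * cis \<theta> \<notin> pencil.critical_values"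
  proof (intro ballI allI impI notI)
    fix \<theta> t :: real assume that: "\<theta> \<in> J" "t > 0"
    assume "of_real t * cis \<theta> \<in> pencil.critical_values"
    moreover have "Arg (of_real t * cis \<theta>) = \<theta>"
      using that J' by (intro Arg_unique'[of t]) (auto simp: rcis_def)
    ultimately have "\<theta> \<in> exceptional_angles" unfolding exceptional_angles_def by (metis imageI)
    then show False using that J(4) by blast
  qed
  obtain I :: "complex set" and \<sigma> :: "real \<Rightarrow> complex \<Rightarrow> real \<Rightarrow> complex"
    and start :: "complex \<Rightarrow> real" and finish :: "complex \<Rightarrow> real option"
    where start: "bij_betw start I L"
      and finish: "bij_betw finish I (insert None (Some ` pencil.zeros))"
      and family: "\<forall>\<theta>\<in>J. (\<Union>t\<in>{0<..}. pencil.roots (of_real t * cis \<theta>)) = (\<Union>i\<in>I. \<sigma> \<theta> i ` {0<..}) \<and>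
        disjoint_family_on (\<lambda>i. \<sigma> \<theta> i ` {0<..}) I"
      and curves: "\<forall>\<theta>\<in>J. \<forall>i\<in>I. simple_analytic_curve (\<sigma> \<theta> i) \<and>
        starts_at (\<sigma> \<theta> i) (of_real (start i)) \<and>
        (case finish i of None \<Rightarrow> ends_at_infinity (\<sigma> \<theta> i) | Some d \<Rightarrow> ends_at (\<sigma> \<theta> i) (of_real d))"
    by (rule pencil.curves_over_regular_interval[OF J(1-3) J' regular]) (rule that; assumption)
  define f where "f = inv_into I start \<circ> lam"
  have f: "bij_betw f {1..N} I"
    unfolding f_def by (rule bij_betw_trans[OF lam_bij bij_betw_inv_into[OF start]])
  have start_f: "start (f r) = lam r" if "r \<in> {1..N}" for r
    using bij_betw_inv_into_right[OF start] lam_bij that by (auto simp: f_def bij_betw_def)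
  define target where "target k = (if k = N then None else Some (delta k))" for k
  have N: "N > 0" using N_eq pencil.card_L_pos by simp
  have split_N: "{1..N} = insert N {1..N - 1}" using N by auto
  have target: "bij_betw target {1..N} (insert None (Some ` pencil.zeros))"
    unfolding bij_betw_def
  proof
    have "inj_on delta {1..N - 1}" using delta_bij by (simp add: bij_betw_def)
    then show "inj_on target {1..N}" by (auto simp: inj_on_def target_def)
    have "target ` {1..N} = insert None ((\<lambda>k. Some (delta k)) ` {1..N - 1})"
      unfolding split_N image_insert using N by (auto simp: target_def image_iff)
    also have "(\<lambda>k. Some (delta k)) ` {1..N - 1} = Some ` delta ` {1..N - 1}" by (simp add: image_image)
    also have "delta ` {1..N - 1} = pencil.zeros" using delta_bij by (simp add: bij_betw_def)
    finally show "target ` {1..N} = insert None (Some ` pencil.zeros)" .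
  qed
  define p where "p r = (if r \<in> {1..N} then inv_into {1..N} target (finish (f r)) else r)" for r
  have "bij_betw (inv_into {1..N} target \<circ> (finish \<circ> f)) {1..N} {1..N}"
    by (rule bij_betw_trans[OF bij_betw_trans[OF f finish] bij_betw_inv_into[OF target]])
  then have "bij_betw p {1..N} {1..N}"
    by (rule bij_betw_cong[THEN iffD1, rotated]) (simp add: p_def)
  then have p: "p permutes {1..N}" by (rule bij_imp_permutes) (auto simp: p_def)
  have target_p: "target (p r) = finish (f r)" if r: "r \<in> {1..N}" for r
  proof -
    have "finish (f r) \<in> insert None (Some ` pencil.zeros)"
      using bij_betwE[OF finish] bij_betwE[OF f] r by blast
    then show ?thesis unfolding p_def using r bij_betw_inv_into_right[OF target] by simp
  qed
  have "curves_with_permutation \<theta> p" if \<theta>: "\<theta> \<in> J" for \<theta>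
    unfolding curves_with_permutation_def
  proof (intro conjI exI[of _ "\<lambda>r. \<sigma> \<theta> (f r)"] ballI)
    show "p permutes {1..N}" by (rule p)
    have "(\<Union>i\<in>I. \<sigma> \<theta> i ` {0<..}) = (\<Union>i\<in>f ` {1..N}. \<sigma> \<theta> i ` {0<..})"
      using f by (simp add: bij_betw_def)
    moreover have "spectral_curve \<theta> = (\<Union>i\<in>I. \<sigma> \<theta> i ` {0<..})"
      using family \<theta> by (simp add: spectral_curve_eq)
    ultimately show "spectral_curve \<theta> = (\<Union>r\<in>{1..N}. \<sigma> \<theta> (f r) ` {0<..})" by simp
    show "disjoint_family_on (\<lambda>r. \<sigma> \<theta> (f r) ` {0<..}) {1..N}"
      unfolding disjoint_family_on_def
    proof (intro ballI impI)
      fix r s assume rs: "r \<in> {1..N}" "s \<in> {1..N}" "r \<noteq> s"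
      then have "f r \<in> I" "f s \<in> I" "f r \<noteq> f s"
        using bij_betwE[OF f] inj_onD[OF bij_betw_imp_inj_on[OF f], of r s] by blast+
      then show "\<sigma> \<theta> (f r) ` {0<..} \<inter> \<sigma> \<theta> (f s) ` {0<..} = {}"
        using family \<theta> by (simp add: disjoint_family_on_def)
    qed
    fix r assume r: "r \<in> {1..N}"
    then have fr: "f r \<in> I" using bij_betwE[OF f] by blast
    have curve: "simple_analytic_curve (\<sigma> \<theta> (f r)) \<and> starts_at (\<sigma> \<theta> (f r)) (of_real (start (f r))) \<and>
        (case finish (f r) of None \<Rightarrow> ends_at_infinity (\<sigma> \<theta> (f r))
          | Some d \<Rightarrow> ends_at (\<sigma> \<theta> (f r)) (of_real d))"
      using curves \<theta> fr by blast
    show "simple_analytic_curve (\<sigma> \<theta> (f r))" using curve by blast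
    show "starts_at (\<sigma> \<theta> (f r)) (of_real (lam r))" using curve start_f[OF r] by simp
    show "if p r = N then ends_at_infinity (\<sigma> \<theta> (f r))
        else ends_at (\<sigma> \<theta> (f r)) (of_real (delta (p r)))"
      using curve unfolding target_p[OF r, symmetric] by (simp add: target_def split: if_splits)
  qed
  then show ?thesis by blast
qed

text \<open>On each component one permutation serves all angles. Choosing it as a function of the component
  makes \<open>\<tau>\<close> constant on components.\<close>

lemma exceptional_set_exists: "\<exists>T \<tau>. exceptional_set_with_permutations T \<tau>"
proof -
  define T where "T = exceptional_angles"
  define D where "D = {0<..<pi} - T"
  define \<tau> where "\<tau> \<theta> = (SOME p. \<forall>\<theta>'\<in>connected_component_set D \<theta>. curves_with_permutation \<theta>' p)" for \<theta>
  have finite_T: "finite T"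
    unfolding T_def exceptional_angles_def by (intro finite_imageI pencil.finite_critical_values)
  have "open D" unfolding D_def using finite_T by (intro open_Diff finite_imp_closed) auto
  have \<tau>: "curves_with_permutation \<theta>' (\<tau> \<theta>)"
    if \<theta>: "\<theta> \<in> D" "\<theta>' \<in> connected_component_set D \<theta>" for \<theta> \<theta>'
  proof -
    define J where "J = connected_component_set D \<theta>"
    have "\<exists>p. \<forall>\<theta>\<in>J. curves_with_permutation \<theta> p"
    proof (rule permutation_over_regular_interval)
      show "open J" unfolding J_def using \<open>open D\<close> by (rule open_connected_component)
      show "connected J" unfolding J_def by (rule connected_connected_component)
      show "J \<noteq> {}" unfolding J_def using \<theta>(2) by blast
      show "J \<subseteq> {0<..<pi} - exceptional_angles"
        unfolding J_def using connected_component_subset[of D \<theta>] by (simp add: D_def T_def)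
    qed
    from someI_ex[OF this] show ?thesis using \<theta>(2) unfolding \<tau>_def J_def by blast
  qed
  have "T \<subseteq> {0<..<pi}"
    unfolding T_def exceptional_angles_def pencil.critical_values_def using Arg_lt_pi by auto
  moreover have "\<forall>\<theta>\<in>D. curves_with_permutation \<theta> (\<tau> \<theta>)"
    using \<tau> connected_component_refl by blast
  moreover have "\<tau> constant_on J" if J: "J \<in> components D" for J
  proof -
    from J obtain \<theta> where \<theta>: "\<theta> \<in> D" "J = connected_component_set D \<theta>" by (auto simp: components_def)
    have "\<tau> \<theta>' = \<tau> \<theta>" if "\<theta>' \<in> J" for \<theta>'
    proof -
      have "connected_component_set D \<theta>' = connected_component_set D \<theta>"
        using that connected_component_eq unfolding \<theta>(2) by metis
      then show ?thesis by (simp add: \<tau>_def)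
    qed
    then show ?thesis unfolding constant_on_def by blast
  qed
  ultimately have "exceptional_set_with_permutations T \<tau>"
    using finite_T unfolding exceptional_set_with_permutations_def D_def by blast
  then show ?thesis by blast
qed

end

lemma (in cyclic_self_adjoint) exists_exceptional_set:
  "\<exists>T \<tau>. exceptional_set_with_permutations T \<tau>"
proof -
  obtain L :: "real set" and u where L: "finite L"
    "\<forall>x\<in>L. u x \<in> H \<and> u x \<noteq> 0 \<and> A (u x) = of_real x *\<^sub>C u x" "e = (\<Sum>x\<in>L. u x)"
    by (rule eigenvector_decomposition)
  interpret eigenbasis scale H ip A e L u
    by unfold_locales (use L in auto)
  show ?thesis by (rule exceptional_set_exists)
qed

section \<open>An operator whose permutation changes\<close>

text \<open>Near \<open>t0\<close> the function is a complex power series composed with \<open>t \<mapsto> t - t0\<close>.\<close>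

lemma real_analytic_on_imp_continuous_on:
  assumes "real_analytic_on f S" "open S"
  shows "continuous_on S f"
proof -
  have "isCont f t0" if t0: "t0 \<in> S" for t0
  proof -
    obtain a r where "r > 0" and sums: "\<And>t. \<lbrakk>t \<in> S; \<bar>t - t0\<bar> < r\<rbrakk> \<Longrightarrow> (\<lambda>n. a n * of_real (t - t0) ^ n) sums f t"
      using assms(1) t0 unfolding real_analytic_on_def by metis
    obtain d where d: "d > 0" "ball t0 d \<subseteq> S" using assms(2) t0 open_contains_ball by blast
    define k where "k = min d r / 2"
    have k: "0 < k" "k < d" "k < r" using d(1) \<open>r > 0\<close> by (auto simp: k_def min_def)
    define g where "g z = (\<Sum>n. a n * z ^ n)" for z :: complex
    have "t0 + k \<in> S" using subsetD[OF d(2), of "t0 + k"] k by (simp add: dist_real_def)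
    then have "summable (\<lambda>n. a n * complex_of_real k ^ n)"
      using sums[of "t0 + k"] k by (simp add: sums_iff)
    then have "isCont g 0" unfolding g_def[abs_def] by (rule isCont_powser) (use k in simp)
    then have "isCont g (complex_of_real (t0 - t0))" by simp
    then have "isCont (\<lambda>t. g (complex_of_real (t - t0))) t0"
      by (intro isCont_o2[of t0 "\<lambda>t. complex_of_real (t - t0)" g] continuous_intros)
    moreover have eq: "\<forall>\<^sub>F t in nhds t0. g (of_real (t - t0)) = f t"
    proof -
      have "\<forall>\<^sub>F t in nhds t0. t \<in> ball t0 k" using k(1) by (intro eventually_nhds_in_open) auto
      then show ?thesis
      proof eventually_elim
        case (elim t)
        then have "(\<lambda>n. a n * of_real (t - t0) ^ n) sums f t"
          using k d(2) by (intro sums) (auto simp: dist_real_def abs_minus_commute)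
        then show ?case by (simp add: g_def sums_iff)
      qed
    qed
    ultimately show ?thesis using isCont_cong[OF eq] by simp
  qed
  then show ?thesis by (simp add: continuous_at_imp_continuous_on)
qed

text \<open>The space \<open>\<complex>\<^sup>2\<close>, realised as the sequences supported on \<open>{0, 1}\<close>.\<close>

definition plane :: "(nat \<Rightarrow> complex) set"
  where "plane = {f. \<forall>n\<ge>2. f n = 0}"

definition plane_scale :: "complex \<Rightarrow> (nat \<Rightarrow> complex) \<Rightarrow> nat \<Rightarrow> complex"
  where "plane_scale c f = (\<lambda>n. c * f n)"

definition plane_ip :: "(nat \<Rightarrow> complex) \<Rightarrow> (nat \<Rightarrow> complex) \<Rightarrow> complex"
  where "plane_ip f g = f 0 * cnj (g 0) + f 1 * cnj (g 1)"

definition vec2 :: "complex \<Rightarrow> complex \<Rightarrow> nat \<Rightarrow> complex"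
  where "vec2 a b = (\<lambda>n. if n = 0 then a else if n = 1 then b else 0)"

definition swap_op :: "(nat \<Rightarrow> complex) \<Rightarrow> nat \<Rightarrow> complex"
  where "swap_op f = vec2 (f 1) (f 0)"

lemma vec2_in_plane: "vec2 a b \<in> plane"
  by (simp add: plane_def vec2_def)

lemma plane_eq_vec2:
  assumes "f \<in> plane" shows "f = vec2 (f 0) (f 1)"
proof
  fix n
  show "f n = vec2 (f 0) (f 1) n"
  proof (cases "n < 2")
    case True
    then have "n = 0 \<or> n = 1" by auto
    then show ?thesis by (auto simp: vec2_def)
  next
    case False
    then show ?thesis using assms by (simp add: plane_def vec2_def)
  qed
qed

lemma vec2_ops:
  "vec2 a b + vec2 c d = vec2 (a + c) (b + d)"
  "plane_scale k (vec2 a b) = vec2 (k * a) (k * b)"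
  "vec2 a b = vec2 c d \<longleftrightarrow> a = c \<and> b = d"
  "swap_op (vec2 a b) = vec2 b a"
  "plane_ip (vec2 a b) (vec2 c d) = a * cnj c + b * cnj d"
  "vec2 0 0 = 0"
  "vec2 a b = 0 \<longleftrightarrow> a = 0 \<and> b = 0"
proof -
  show zero: "vec2 0 0 = 0" by (auto simp: vec2_def fun_eq_iff)
  show "vec2 a b = vec2 c d \<longleftrightarrow> a = c \<and> b = d"
  proof
    assume "vec2 a b = vec2 c d"
    then have "vec2 a b 0 = vec2 c d 0" "vec2 a b 1 = vec2 c d 1" by simp_all
    then show "a = c \<and> b = d" by (simp add: vec2_def)
  qed simp
  show "vec2 a b = 0 \<longleftrightarrow> a = 0 \<and> b = 0"
  proof
    assume "vec2 a b = 0"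
    then have "vec2 a b 0 = 0" "vec2 a b 1 = 0" by simp_all
    then show "a = 0 \<and> b = 0" by (simp add: vec2_def)
  qed (simp add: zero)
qed (auto simp: vec2_def plane_scale_def swap_op_def plane_ip_def fun_eq_iff)

interpretation plane: vector_space plane_scale
  by unfold_locales (auto simp: plane_scale_def fun_eq_iff algebra_simps)

lemma subspace_plane: "plane.subspace plane"
  by (rule plane.subspaceI) (auto simp: plane_def plane_scale_def)

lemma span_basis: "plane.span {vec2 1 0, vec2 0 1} = plane"
proof
  show "plane.span {vec2 1 0, vec2 0 1} \<subseteq> plane"
    by (rule plane.span_minimal[OF _ subspace_plane]) (simp add: vec2_in_plane)
  show "plane \<subseteq> plane.span {vec2 1 0, vec2 0 1}"
  proof
    fix f assume "f \<in> plane"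
    then have "f = vec2 (f 0) (f 1)" by (rule plane_eq_vec2)
    also have "\<dots> = plane_scale (f 0) (vec2 1 0) + plane_scale (f 1) (vec2 0 1)"
      by (simp add: vec2_ops)
    also have "\<dots> \<in> plane.span {vec2 1 0, vec2 0 1}"
      by (intro plane.span_add plane.span_scale plane.span_base) auto
    finally show "f \<in> plane.span {vec2 1 0, vec2 0 1}" .
  qed
qed

interpretation plane: finite_dim_hilbert_space plane_scale plane plane_ip
proof
  show "plane.subspace plane" by (rule subspace_plane)
  show "\<exists>B. finite B \<and> plane.span B = plane"
    by (rule exI[of _ "{vec2 1 0, vec2 0 1}"]) (simp add: span_basis)
  fix f assume f: "f \<in> plane" "f \<noteq> 0"
  have fv: "f = vec2 (f 0) (f 1)" using f(1) by (rule plane_eq_vec2)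
  have "f 0 \<noteq> 0 \<or> f 1 \<noteq> 0"
  proof (rule ccontr)
    assume "\<not> ?thesis"
    then have "f = vec2 0 0" using fv by simp
    then show False using f(2) by (simp add: vec2_ops)
  qed
  moreover have "Re (plane_ip f f) = (cmod (f 0))\<^sup>2 + (cmod (f 1))\<^sup>2"
    by (simp add: plane_ip_def cmod_power2 flip: power2_eq_square)
  ultimately show "Re (plane_ip f f) > 0" by (auto simp: add_pos_nonneg add_nonneg_pos)
qed (auto simp: plane_ip_def plane_scale_def algebra_simps)

interpretation swap: cyclic_self_adjoint plane_scale plane plane_ip swap_op "vec2 1 0"
proof
  show "plane.linear_operator swap_op"
    unfolding plane.linear_operator_def
  proof (intro conjI ballI allI)
    show "swap_op ` plane \<subseteq> plane" by (auto simp: swap_op_def vec2_in_plane)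
  qed (auto simp: swap_op_def plane_scale_def vec2_def fun_eq_iff)
  show "plane.self_adjoint swap_op"
    by (simp add: plane.self_adjoint_def swap_op_def plane_ip_def vec2_def)
  show "plane.cyclic_vector (vec2 1 0) swap_op"
    unfolding plane.cyclic_vector_def
  proof
    show "vec2 1 0 \<in> plane" by (rule vec2_in_plane)
    have "(swap_op ^^ n) (vec2 1 0) \<in> plane" for n
      by (induction n) (auto simp: vec2_in_plane swap_op_def)
    then have "plane.span (range (\<lambda>n. (swap_op ^^ n) (vec2 1 0))) \<subseteq> plane"
      by (intro plane.span_minimal subspace_plane) auto
    moreover have "{vec2 1 0, vec2 0 1} \<subseteq> range (\<lambda>n. (swap_op ^^ n) (vec2 1 0))"
    proof -
      have "vec2 1 0 = (swap_op ^^ 0) (vec2 1 0)" "vec2 0 1 = (swap_op ^^ 1) (vec2 1 0)"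
        by (simp_all add: vec2_ops)
      then show ?thesis by blast
    qed
    then have "plane \<subseteq> plane.span (range (\<lambda>n. (swap_op ^^ n) (vec2 1 0)))"
      unfolding span_basis[symmetric] by (rule plane.span_mono)
    ultimately show "plane.span (range (\<lambda>n. (swap_op ^^ n) (vec2 1 0))) = plane" by blast
  qed
  show "plane_ip (vec2 1 0) (vec2 1 0) = 1" by (simp add: vec2_ops)
qed

text \<open>The eigenvectors of \<open>swap_op\<close> for \<open>-1\<close> and \<open>1\<close>, scaled so that their sum is the first unit vector.\<close>

interpretation swap: eigenbasis plane_scale plane plane_ip swap_op "vec2 1 0" "{-1, 1}"
  "\<lambda>x. vec2 (1/2) (of_real x / 2)"
  by unfold_locales (auto simp: vec2_ops vec2_in_plane)

lemma swap_roots: "swap.pencil.roots \<gamma> = {z. z\<^sup>2 - 1 = \<gamma> * z}"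
proof -
  have w: "swap.weight 1 = 1/2" "swap.weight (-1) = 1/2"
    by (simp_all add: swap.weight_def vec2_ops)
  have "{-1, 1} - {1} = {-1 :: real}" "{-1, 1} - {-1} = {1 :: real}" by auto
  then have "poly swap.pencil.Q z = z" for z
    unfolding swap.pencil.poly_Q by (simp add: w field_simps)
  moreover have "poly swap.pencil.P z = z\<^sup>2 - 1" for z
    unfolding swap.pencil.poly_P by (simp add: algebra_simps power2_eq_square)
  ultimately show ?thesis by (simp add: swap.pencil.roots_def)
qed

lemma swap_endpoints: "swap.N = 2" "swap.lam 2 = 1" "swap.delta 1 = 0"
proof -
  show N: "swap.N = 2" by (simp add: swap.N_eq)
  have "sorted_list_of_set {-1, 1 :: real} = [-1, 1]" by (simp add: sorted_list_of_set.fold_insort_key.remove)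
  then show "swap.lam 2 = 1"
    by (simp add: swap.lam_def plane.ordered_eigenvalue_def swap.eigenvalues_A)
  have "0 \<in> swap.pencil.zeros"
  proof -
    have "{-1, 1} - {1} = {-1 :: real}" "{-1, 1} - {-1} = {1 :: real}" by auto
    moreover have "swap.weight 1 = 1/2" "swap.weight (-1) = 1/2"
      by (simp_all add: swap.weight_def vec2_ops)
    ultimately show ?thesis
      unfolding swap.pencil.zeros_def by (simp add: swap.pencil.poly_Q)
  qed
  moreover have "swap.delta ` {1..1} = swap.pencil.zeros"
    using swap.delta_bij N by (simp add: bij_betw_def)
  moreover have "card swap.pencil.zeros = 1" using swap.pencil.card_zeros by simp
  ultimately show "swap.delta 1 = 0" by (auto simp: card_1_singleton_iff)
qed

text \<open>The real part of \<open>z - 1 / z = t * cis \<theta>\<close>, multiplied by \<open>\<bar>z\<bar>\<^sup>2\<close>.\<close>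

lemma swap_curve_regions:
  assumes "z \<in> swap.spectral_curve \<theta>"
  obtains c where "c > 0" "c * cos \<theta> = Re z * ((cmod z)\<^sup>2 - 1)"
proof -
  obtain t where t: "t > 0" "z\<^sup>2 - 1 = of_real t * cis \<theta> * z"
    using assms by (auto simp: swap.spectral_curve_eq swap_roots)
  then have z: "z \<noteq> 0" by auto
  have zz: "z * cnj z = of_real ((cmod z)\<^sup>2)" using complex_norm_square[of z] by simp
  have "(z\<^sup>2 - 1) * cnj z = z * (z * cnj z) - cnj z" by (simp add: power2_eq_square algebra_simps)
  also have "\<dots> = z * of_real ((cmod z)\<^sup>2) - cnj z" by (simp only: zz)
  finally have "z * of_real ((cmod z)\<^sup>2) - cnj z = of_real t * cis \<theta> * (z * cnj z)"
    using t(2) by (simp add: mult.assoc)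
  then have "z * of_real ((cmod z)\<^sup>2) - cnj z = of_real t * cis \<theta> * of_real ((cmod z)\<^sup>2)"
    by (simp only: zz)
  then have "Re (z * of_real ((cmod z)\<^sup>2) - cnj z) = Re (of_real t * cis \<theta> * of_real ((cmod z)\<^sup>2))"
    by (rule arg_cong)
  then have "t * (cmod z)\<^sup>2 * cos \<theta> = Re z * ((cmod z)\<^sup>2 - 1)" by (simp add: algebra_simps)
  moreover have "t * (cmod z)\<^sup>2 > 0" using t(1) z by simp
  ultimately show thesis using that by blast
qed

text \<open>A curve in the family is connected and, if \<open>cos \<theta> \<noteq> 0\<close>, it does not meet the imaginary axis, so
  the one that starts at \<open>1\<close> stays to the right of it. It belongs to an arbitrary decomposition of
  \<open>S\<^sub>\<theta>\<close>, since a change of the permutation has to be shown for every admissible \<open>T\<close> and \<open>\<tau>\<close>.\<close>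

lemma swap_curve_right_half_plane:
  assumes "swap.curves_with_permutation \<theta> p" "cos \<theta> \<noteq> 0"
  obtains \<sigma> where "\<And>t. t > 0 \<Longrightarrow> \<sigma> t \<in> swap.spectral_curve \<theta> \<and> Re (\<sigma> t) > 0"
    "if p 2 = 2 then ends_at_infinity \<sigma> else ends_at \<sigma> (of_real (swap.delta (p 2)))"
proof -
  obtain \<sigma>s where \<sigma>s: "swap.spectral_curve \<theta> = (\<Union>r\<in>{1..swap.N}. \<sigma>s r ` {0<..})"
    "\<forall>r\<in>{1..swap.N}. simple_analytic_curve (\<sigma>s r) \<and> starts_at (\<sigma>s r) (of_real (swap.lam r)) \<and>
      (if p r = swap.N then ends_at_infinity (\<sigma>s r) else ends_at (\<sigma>s r) (of_real (swap.delta (p r))))"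
    using assms(1) unfolding swap.curves_with_permutation_def by blast
  define \<sigma> where "\<sigma> = \<sigma>s 2"
  have two: "2 \<in> {1..swap.N}" by (simp add: swap_endpoints)
  have \<sigma>: "simple_analytic_curve \<sigma>" "starts_at \<sigma> 1"
    "if p 2 = 2 then ends_at_infinity \<sigma> else ends_at \<sigma> (of_real (swap.delta (p 2)))"
    using bspec[OF \<sigma>s(2) two] by (simp_all add: \<sigma>_def swap_endpoints)
  have on_curve: "\<sigma> t \<in> swap.spectral_curve \<theta>" if "t > 0" for t
    unfolding \<sigma>s(1) \<sigma>_def using two that by blast
  have Re_nz: "Re (\<sigma> t) \<noteq> 0" if "t > 0" for t
    using swap_curve_regions[OF on_curve[OF that]] assms(2) by (metis less_irrefl mult_eq_0_iff)
  have "continuous_on {0<..} \<sigma>"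
    using \<sigma>(1) by (intro real_analytic_on_imp_continuous_on) (auto simp: simple_analytic_curve_def)
  then have "connected (\<sigma> ` {0<..})" by (intro connected_continuous_image) auto
  from connectedD[OF this open_halfspace_Re_gt[of 0] open_halfspace_Re_lt[of 0]]
  have "{z. Re z > 0} \<inter> \<sigma> ` {0<..} = {} \<or> {z. Re z < 0} \<inter> \<sigma> ` {0<..} = {}"
    using Re_nz by (force simp: neq_iff)
  moreover have "{z. Re z > 0} \<inter> \<sigma> ` {0<..} \<noteq> {}"
  proof -
    have "((\<lambda>t. Re (\<sigma> t)) \<longlongrightarrow> Re 1) (at_right 0)"
      using \<sigma>(2) unfolding starts_at_def by (rule tendsto_Re)
    then have "\<forall>\<^sub>F t in at_right 0. Re (\<sigma> t) > 0" by (rule order_tendstoD) simp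
    then have "\<forall>\<^sub>F t in at_right (0::real). Re (\<sigma> t) > 0 \<and> t > 0"
      using eventually_at_right_less[of 0] by eventually_elim simp
    from eventually_happens'[OF trivial_limit_at_right_real this] show ?thesis by blast
  qed
  ultimately have "{z. Re z < 0} \<inter> \<sigma> ` {0<..} = {}" by blast
  then have "Re (\<sigma> t) > 0" if "t > 0" for t
    using Re_nz[OF that] that by (force simp: neq_iff)
  then show thesis using that[of \<sigma>] on_curve \<sigma>(3) by blast
qed

text \<open>In the right half-plane \<open>\<bar>z\<bar> - 1\<close> has the sign of \<open>cos \<theta>\<close> along the curve. So the curve that starts
  at \<open>1\<close> cannot end at \<open>0\<close> in the first case, and cannot tend to infinity in the second.\<close>

lemma swap_permutation:
  assumes "swap.curves_with_permutation \<theta> p"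
  shows "cos \<theta> > 0 \<Longrightarrow> p 2 = 2" "cos \<theta> < 0 \<Longrightarrow> p 2 \<noteq> 2"
proof -
  have "p permutes {1..2}"
    using assms swap_endpoints(1) by (simp add: swap.curves_with_permutation_def)
  then have "p 2 \<in> {1..2}" by (subst permutes_in_image) auto
  then have p2: "p 2 = 1 \<or> p 2 = 2" by auto
  show "p 2 = 2" if c: "cos \<theta> > 0"
  proof (rule ccontr)
    assume n: "p 2 \<noteq> 2"
    have "cos \<theta> \<noteq> 0" using c by simp
    from swap_curve_right_half_plane[OF assms this] obtain \<sigma> where
      \<sigma>: "\<And>t. t > 0 \<Longrightarrow> \<sigma> t \<in> swap.spectral_curve \<theta> \<and> Re (\<sigma> t) > 0"
        "if p 2 = 2 then ends_at_infinity \<sigma> else ends_at \<sigma> (of_real (swap.delta (p 2)))" by metis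
    have big: "cmod (\<sigma> t) > 1" if t: "t > 0" for t
    proof -
      have "\<sigma> t \<in> swap.spectral_curve \<theta>" using \<sigma>(1)[OF t] by blast
      then obtain k where k: "k > 0" "k * cos \<theta> = Re (\<sigma> t) * ((cmod (\<sigma> t))\<^sup>2 - 1)"
        by (rule swap_curve_regions)
      have "Re (\<sigma> t) * ((cmod (\<sigma> t))\<^sup>2 - 1) > 0" using k c by (metis mult_pos_pos)
      then have "(cmod (\<sigma> t))\<^sup>2 > 1\<^sup>2" using \<sigma>(1)[OF t] by (simp add: zero_less_mult_iff)
      then show ?thesis using power2_less_imp_less norm_ge_zero by blast
    qed
    have "p 2 = 1" using n p2 by simp
    then have "(\<sigma> \<longlongrightarrow> 0) at_top" using \<sigma>(2) swap_endpoints(3) by (simp add: ends_at_def)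
    then have "\<forall>\<^sub>F t in at_top. dist (\<sigma> t) 0 < 1" by (rule tendstoD) simp
    then have "\<forall>\<^sub>F t :: real in at_top. False"
      using eventually_gt_at_top[of 0]
    proof eventually_elim
      case (elim t)
      then show ?case using big[of t] by simp
    qed
    then show False by simp
  qed
  show "p 2 \<noteq> 2" if c: "cos \<theta> < 0"
  proof
    assume n: "p 2 = 2"
    have "cos \<theta> \<noteq> 0" using c by simp
    from swap_curve_right_half_plane[OF assms this] obtain \<sigma> where
      \<sigma>: "\<And>t. t > 0 \<Longrightarrow> \<sigma> t \<in> swap.spectral_curve \<theta> \<and> Re (\<sigma> t) > 0"
        "if p 2 = 2 then ends_at_infinity \<sigma> else ends_at \<sigma> (of_real (swap.delta (p 2)))" by metis
    have small: "cmod (\<sigma> t) < 1" if t: "t > 0" for t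
    proof -
      have "\<sigma> t \<in> swap.spectral_curve \<theta>" using \<sigma>(1)[OF t] by blast
      then obtain k where k: "k > 0" "k * cos \<theta> = Re (\<sigma> t) * ((cmod (\<sigma> t))\<^sup>2 - 1)"
        by (rule swap_curve_regions)
      have "Re (\<sigma> t) * ((cmod (\<sigma> t))\<^sup>2 - 1) < 0" using k c by (metis mult_pos_neg)
      then have "(cmod (\<sigma> t))\<^sup>2 < 1\<^sup>2" using \<sigma>(1)[OF t] by (simp add: mult_less_0_iff)
      then show ?thesis using power2_less_imp_less zero_le_one by blast
    qed
    have "filterlim (\<lambda>t. cmod (\<sigma> t)) at_top at_top" using \<sigma>(2) n by (simp add: ends_at_infinity_def)
    then have "\<forall>\<^sub>F t in at_top. 1 \<le> cmod (\<sigma> t)" by (simp add: filterlim_at_top)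
    then have "\<forall>\<^sub>F t :: real in at_top. False"
      using eventually_gt_at_top[of 0]
    proof eventually_elim
      case (elim t)
      then show ?case using small[of t] by simp
    qed
    then show False by simp
  qed
qed

text \<open>As \<open>T\<close> is finite, there are admissible angles on both sides of \<open>\<pi> / 2\<close>.\<close>

lemma swap_permutation_not_constant:
  assumes "swap.exceptional_set_with_permutations T \<tau>"
  shows "\<not> \<tau> constant_on ({0<..<pi} - T)"
proof
  assume const: "\<tau> constant_on ({0<..<pi} - T)"
  have T: "finite T" and curves: "\<And>\<theta>. \<theta> \<in> {0<..<pi} - T \<Longrightarrow> swap.curves_with_permutation \<theta> (\<tau> \<theta>)"
    using assms by (auto simp: swap.exceptional_set_with_permutations_def)
  have avoid: "\<exists>\<theta>. \<theta> \<in> {a<..<b} - T" if "a < b" for a b :: real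
  proof -
    have "infinite ({a<..<b} - T)" using that T by (simp add: infinite_Ioo)
    then show ?thesis by (metis ex_in_conv finite.emptyI)
  qed
  obtain \<theta>1 where \<theta>1: "\<theta>1 \<in> {0<..<pi/2} - T" using avoid[of 0 "pi/2"] by auto
  obtain \<theta>2 where \<theta>2: "\<theta>2 \<in> {pi/2<..<pi} - T" using avoid[of "pi/2" pi] by auto
  have m: "\<theta>1 \<in> {0<..<pi} - T" "\<theta>2 \<in> {0<..<pi} - T" using \<theta>1 \<theta>2 by auto
  have "cos \<theta>1 > 0" using \<theta>1 by (intro cos_gt_zero) auto
  then have "\<tau> \<theta>1 2 = 2" using swap_permutation(1)[OF curves[OF m(1)]] by blast
  moreover have "cos \<theta>2 < 0"
  proof -
    have "0 < cos (pi - \<theta>2)" using \<theta>2 by (intro cos_gt_zero) auto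
    then show ?thesis by simp
  qed
  then have "\<tau> \<theta>2 2 \<noteq> 2" using swap_permutation(2)[OF curves[OF m(2)]] by blast
  moreover have "\<tau> \<theta>1 = \<tau> \<theta>2" using const m unfolding constant_on_def by metis
  ultimately show False by simp
qed

theorem theorem36:
  shows "(\<forall>(scale :: complex \<Rightarrow> 'a::ab_group_add \<Rightarrow> 'a) H ip A e.
            cyclic_self_adjoint scale H ip A e \<longrightarrow>
            (\<exists>T \<tau>. cyclic_self_adjoint.exceptional_set_with_permutations scale H ip A e T \<tau>))
       \<and> (\<exists>(scale :: complex \<Rightarrow> (nat \<Rightarrow> complex) \<Rightarrow> (nat \<Rightarrow> complex)) H ip A e.
            cyclic_self_adjoint scale H ip A e \<and>
            (\<exists>T \<tau>. cyclic_self_adjoint.exceptional_set_with_permutations scale H ip A e T \<tau>) \<and>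
            (\<forall>T \<tau>. cyclic_self_adjoint.exceptional_set_with_permutations scale H ip A e T \<tau> \<longrightarrow>
                   \<not> \<tau> constant_on ({0<..<pi} - T)))"
proof
  show "\<forall>(scale :: complex \<Rightarrow> 'a \<Rightarrow> 'a) H ip A e.
      cyclic_self_adjoint scale H ip A e \<longrightarrow>
      (\<exists>T \<tau>. cyclic_self_adjoint.exceptional_set_with_permutations scale H ip A e T \<tau>)"
    using cyclic_self_adjoint.exists_exceptional_set by blast
  show "\<exists>(scale :: complex \<Rightarrow> (nat \<Rightarrow> complex) \<Rightarrow> (nat \<Rightarrow> complex)) H ip A e.
      cyclic_self_adjoint scale H ip A e \<and>
      (\<exists>T \<tau>. cyclic_self_adjoint.exceptional_set_with_permutations scale H ip A e T \<tau>) \<and>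
      (\<forall>T \<tau>. cyclic_self_adjoint.exceptional_set_with_permutations scale H ip A e T \<tau> \<longrightarrow>
             \<not> \<tau> constant_on ({0<..<pi} - T))"
    by (rule exI[of _ plane_scale], rule exI[of _ plane], rule exI[of _ plane_ip],
        rule exI[of _ swap_op], rule exI[of _ "vec2 1 0"])
      (intro conjI allI impI swap.cyclic_self_adjoint_axioms swap.exceptional_set_exists
        swap_permutation_not_constant)
qed

end
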